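(* Let $k$ be a field, $\Sigma$ a rational pointed fan in $\mathbb{R}^d$ ($d\ge 1$), $\mathcal{M}=(M_C)_{C\in\Sigma}$ a monoidal complex supported on $\Sigma$, and $k[\mathcal{M}]$ its toric face ring. If $k[\mathcal{M}]$ is a seminormal ring, then for every cone $C\in\Sigma$ the affine monoid ring $k[M_C]$ is seminormal. Conversely, if for each cone $C\in\Sigma$ the monoid $M_C$ is seminormal, then the toric face ring $k[\mathcal{M}]$ is also seminormal.
   Context: Cones: a cone in $\mathbb{R}^d$ is a finite intersection of closed half-spaces bounded by hyperplanes through the origin. It is rational if the hyperplanes can be defined by homogeneous linear equations with integer coefficients. A face of a cone $C$ is $C$ itself or the intersection of $C$ with a supporting hyperplane through the origin. $C$ is pointed if $\{0\}$ is a face of $C$. All cones are rational and pointed. Monoids: an affine monoid is a finitely generated submonoid $M$ of some $\mathbb{Z}^d$; $\mathbb{Z}M$ is the subgroup it generates and $\mathbb{R}_+M$ the cone of nonnegative real combinations of its elements. $M$ is seminormal if every $x\in\mathbb{Z}M$ with $2x,3x\in M$ lies in $M$. The affine monoid ring $k[M]$ is the monoid algebra. Fans and monoidal complexes: a rational pointed fan $\Sigma$ in $\mathbb{R}^d$ is a finite nonempty set of rational pointed cones such that faces of members are members, and the intersection of two members is a common face of both. A monoidal complex $\mathcal{M}$ supported on $\Sigma$ is a family of affine monoids $(M_C)_{C\in\Sigma}$ with $M_C\subseteq C\cap\mathbb{Z}^d$, $\mathbb{R}_+M_C=C$, and $M_D=M_C\cap D$ whenever $D$ is a face of $C$. Put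 $|\mathcal{M}|=\bigcup_{C\in\Sigma}M_C$. Toric face ring: $k[\mathcal{M}]=\bigoplus_{a\in|\mathcal{M}|}k\,X^a$ as a $k$-vector space, with $X^a\cdot X^b=X^{a+b}$ if $a,b\in M_C$ for some $C\in\Sigma$, and $X^aX^b=0$ otherwise. A reduced ring $R$ is seminormal if whenever $x,y\in R$ satisfy $x^2=y^3$, there is $z\in R$ with $x=z^3$, $y=z^2$. *)

theory Defs
  imports
    "HOL-Analysis.Analysis"
    "HOL-Algebra.Ring"
    "HOL-Library.Poly_Mapping"
    "HOL-Computational_Algebra.Group_Closure"
begin

section \<open>Cones and fans\<close>

definition int_lattice :: "(real ^ 'n) set" where
  "int_lattice = {x. \<forall>i. x $ i \<in> \<int>}"

text \<open>A nonzero integer vector \<open>a\<close> represents the closed half-space \<open>{x. 0 \<le> a \<bullet> x}\<close>, whose bounding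
  hyperplane passes through the origin. The empty family yields the whole space.\<close>

definition rational_cone :: "(real ^ 'n) set \<Rightarrow> bool" where
  "rational_cone C \<longleftrightarrow>
    (\<exists>A. finite A \<and> A \<subseteq> int_lattice - {0} \<and> C = {x. \<forall>a\<in>A. 0 \<le> a \<bullet> x})"

text \<open>Faces are nonempty, and are cut out by hyperplanes through the origin; this differs from
  \<^const>\<open>exposed_face_of\<close>, which allows the empty face and affine hyperplanes.\<close>

definition cone_face :: "(real ^ 'n) set \<Rightarrow> (real ^ 'n) set \<Rightarrow> bool" where
  "cone_face D C \<longleftrightarrow>
    D = C \<or> (\<exists>a. a \<noteq> 0 \<and> (\<forall>x\<in>C. 0 \<le> a \<bullet> x) \<and> D = C \<inter> {x. a \<bullet> x = 0})"

definition pointed_cone :: "(real ^ 'n) set \<Rightarrow> bool" where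
  "pointed_cone C \<longleftrightarrow> cone_face {0} C"

definition rational_pointed_fan :: "(real ^ 'n) set set \<Rightarrow> bool" where
  "rational_pointed_fan \<Sigma> \<longleftrightarrow>
    finite \<Sigma> \<and> \<Sigma> \<noteq> {} \<and>
    (\<forall>C\<in>\<Sigma>. rational_cone C \<and> pointed_cone C) \<and>
    (\<forall>C\<in>\<Sigma>. \<forall>D. cone_face D C \<longrightarrow> D \<in> \<Sigma>) \<and>
    (\<forall>C\<in>\<Sigma>. \<forall>D\<in>\<Sigma>. cone_face (C \<inter> D) C \<and> cone_face (C \<inter> D) D)"

section \<open>Affine monoids and monoidal complexes\<close>

definition additive_submonoid :: "'a::comm_monoid_add set \<Rightarrow> bool" where
  "additive_submonoid M \<longleftrightarrow> 0 \<in> M \<and> (\<forall>x\<in>M. \<forall>y\<in>M. x + y \<in> M)"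

definition affine_monoid :: "(real ^ 'n) set \<Rightarrow> bool" where
  "affine_monoid M \<longleftrightarrow>
    (\<exists>S. finite S \<and> S \<subseteq> int_lattice \<and> M = additive_submonoid hull S)"

definition nonneg_combinations :: "'a::real_vector set \<Rightarrow> 'a set" where
  "nonneg_combinations M =
    {\<Sum>a\<in>F. c a *\<^sub>R a | F c. finite F \<and> F \<subseteq> M \<and> (\<forall>a\<in>F. 0 \<le> c a)}"

definition seminormal_monoid :: "(real ^ 'n) set \<Rightarrow> bool" where
  "seminormal_monoid M \<longleftrightarrow>
    (\<forall>x\<in>group_closure M. 2 *\<^sub>R x \<in> M \<and> 3 *\<^sub>R x \<in> M \<longrightarrow> x \<in> M)"

text \<open>A family \<open>(M\<^sub>C)\<close> indexed by \<open>\<Sigma>\<close> is a function on all sets whose values outside \<open>\<Sigma>\<close> are irrelevant.\<close>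

definition monoidal_complex ::
  "(real ^ 'n) set set \<Rightarrow> ((real ^ 'n) set \<Rightarrow> (real ^ 'n) set) \<Rightarrow> bool" where
  "monoidal_complex \<Sigma> M \<longleftrightarrow>
    (\<forall>C\<in>\<Sigma>. affine_monoid (M C) \<and> M C \<subseteq> C \<inter> int_lattice \<and> nonneg_combinations (M C) = C) \<and>
    (\<forall>C\<in>\<Sigma>. \<forall>D. cone_face D C \<longrightarrow> M D = M C \<inter> D)"

section \<open>Affine monoid rings and toric face rings\<close>

text \<open>The type \<open>real ^ 'n \<Rightarrow>\<^sub>0 'k\<close> with its library multiplication is the monoid algebra
  of the additive group of \<open>real ^ 'n\<close>, with \<open>Poly_Mapping.single a 1\<close> in the role of \<open>X\<^sup>a\<close>;
  \<open>k[M]\<close> is its subring of elements supported on \<open>M\<close>.\<close>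

definition affine_monoid_ring ::
  "(real ^ 'n) set \<Rightarrow> (real ^ 'n \<Rightarrow>\<^sub>0 'k::field) ring" where
  "affine_monoid_ring M =
    \<lparr>carrier = {p. Poly_Mapping.keys p \<subseteq> M}, mult = (*), one = 1, zero = 0, add = (+)\<rparr>"

text \<open>The bilinear extension of \<open>X\<^sup>a X\<^sup>b = X\<^sup>a\<^sup>+\<^sup>b\<close> if \<open>a\<close> and \<open>b\<close> lie in a common \<open>M\<^sub>C\<close>,
  and \<open>X\<^sup>a X\<^sup>b = 0\<close> otherwise.\<close>

definition toric_mult ::
  "(real ^ 'n) set set \<Rightarrow> ((real ^ 'n) set \<Rightarrow> (real ^ 'n) set) \<Rightarrow>
    (real ^ 'n \<Rightarrow>\<^sub>0 'k::field) \<Rightarrow> (real ^ 'n \<Rightarrow>\<^sub>0 'k) \<Rightarrow> (real ^ 'n \<Rightarrow>\<^sub>0 'k)" where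
  "toric_mult \<Sigma> M p q =
    (\<Sum>a\<in>Poly_Mapping.keys p. \<Sum>b\<in>Poly_Mapping.keys q.
      if \<exists>C\<in>\<Sigma>. a \<in> M C \<and> b \<in> M C
      then Poly_Mapping.single (a + b) (Poly_Mapping.lookup p a * Poly_Mapping.lookup q b)
      else 0)"

definition toric_face_ring ::
  "(real ^ 'n) set set \<Rightarrow> ((real ^ 'n) set \<Rightarrow> (real ^ 'n) set) \<Rightarrow>
    (real ^ 'n \<Rightarrow>\<^sub>0 'k::field) ring" where
  "toric_face_ring \<Sigma> M =
    \<lparr>carrier = {p. Poly_Mapping.keys p \<subseteq> (\<Union>C\<in>\<Sigma>. M C)},
     mult = toric_mult \<Sigma> M, one = Poly_Mapping.single 0 1, zero = 0, add = (+)\<rparr>"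

section \<open>Seminormal rings\<close>

definition reduced_ring :: "('a, 'b) ring_scheme \<Rightarrow> bool" where
  "reduced_ring R \<longleftrightarrow>
    (\<forall>x\<in>carrier R. \<forall>n::nat. x [^]\<^bsub>R\<^esub> n = \<zero>\<^bsub>R\<^esub> \<longrightarrow> x = \<zero>\<^bsub>R\<^esub>)"

definition seminormal_ring :: "('a, 'b) ring_scheme \<Rightarrow> bool" where
  "seminormal_ring R \<longleftrightarrow>
    cring R \<and> reduced_ring R \<and>
    (\<forall>x\<in>carrier R. \<forall>y\<in>carrier R. x [^]\<^bsub>R\<^esub> (2::nat) = y [^]\<^bsub>R\<^esub> (3::nat) \<longrightarrow>
      (\<exists>z\<in>carrier R. x = z [^]\<^bsub>R\<^esub> (3::nat) \<and> y = z [^]\<^bsub>R\<^esub> (2::nat)))"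

end

theory Submission
  imports Defs
begin

text \<open>
  The proof has two independent parts.

  \<^emph>\<open>The toric face ring is glued from the rings \<open>k[M\<^sub>C]\<close>.\<close> For \<open>C \<in> \<Sigma>\<close>, forgetting all monomials outside
  \<open>M\<^sub>C\<close> is a ring homomorphism from \<open>k[\<M>]\<close> onto \<open>k[M\<^sub>C]\<close> (\<open>restrict_toric_mult\<close>): since \<open>C \<inter> D\<close> is a face
  of \<open>D\<close>, a sum of two elements of \<open>M\<^sub>D\<close> lies in \<open>M\<^sub>C\<close> only if both summands do. This homomorphism
  splits the inclusion, so a root \<open>z\<close> of \<open>x\<^sup>2 = y\<^sup>3\<close> that exists in \<open>k[\<M>]\<close> restricts to a root in \<open>k[M\<^sub>C]\<close>;
  that is the first implication. For the second, the restrictions are jointly injective, which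
  gives the ring axioms and reducedness of \<open>k[\<M>]\<close>, and a family of elements of the \<open>k[M\<^sub>C]\<close> that agree on
  intersections comes from an element of \<open>k[\<M>]\<close> (\<open>glue\<close>). In a domain \<open>z\<close> is determined by \<open>z\<^sup>2\<close> and \<open>z\<^sup>3\<close>,
  so roots \<open>z\<^sub>C \<in> k[M\<^sub>C]\<close> do agree on intersections. What remains is that \<open>k[M]\<close> has such roots if \<open>M\<close> is a
  seminormal affine monoid.

  \<^emph>\<open>Roots in \<open>k[M]\<close>.\<close> A root is first found in \<open>k[G]\<close> for the group \<open>G\<close> generated by \<open>M\<close>. The fraction
  \<open>x / y\<close> is almost integral: the denominator \<open>y\<close> clears all its powers. Subtracting the quotient of the
  leading monomials of \<open>x\<close> and \<open>y\<close> keeps this property, and almost integrality confines the exponents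
  that are split off in this way to a polytope, which depends only on the maxima of the coordinate
  functions and their negatives on the supports of \<open>x\<close> and \<open>y\<close>. As the polytope has finitely many lattice points and the
  leading exponent drops each time, the division ends and \<open>y\<close> divides \<open>x\<close> (\<open>almost_integral_dvd\<close>). This
  replaces an appeal to unique factorization of Laurent polynomials.

  It is left to see that \<open>z \<in> k[G]\<close> has support in \<open>M\<close> when \<open>z\<^sup>2, z\<^sup>3 \<in> k[M]\<close>
  (\<open>seminormal_monoid_root_closed\<close>). The support lies in the cone of \<open>M\<close>. For an exponent \<open>a\<close> of \<open>z\<close> let \<open>F\<close>
  be the smallest face of \<open>M\<close> over which \<open>a\<close> lies. Restriction to that face is multiplicative, so
  the restricted element has its square and cube in \<open>k[F]\<close>; by the first step and uniqueness of
  roots it is in \<open>k[F - F]\<close>. So \<open>a\<close> is a point of \<open>F - F\<close> interior to the cone of \<open>F\<close>,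
  hence all large multiples of \<open>a\<close> are in \<open>M\<close>, and seminormality descends from there to \<open>a\<close> itself.
\<close>

section \<open>Supports and coefficients in monoid algebras\<close>

abbreviation supp :: "('a \<Rightarrow>\<^sub>0 'b::zero) \<Rightarrow> 'a set" where
  "supp \<equiv> Poly_Mapping.keys"

abbreviation coeff :: "('a \<Rightarrow>\<^sub>0 'b::zero) \<Rightarrow> 'a \<Rightarrow> 'b" where
  "coeff \<equiv> Poly_Mapping.lookup"

abbreviation monomial :: "'a \<Rightarrow> 'b \<Rightarrow> ('a \<Rightarrow>\<^sub>0 'b::zero)" where
  "monomial \<equiv> Poly_Mapping.single"

lemma sum_monomials:
  assumes "finite A" "supp p \<subseteq> A"
  shows "(\<Sum>a\<in>A. monomial a (coeff p a)) = p"
proof (rule poly_mapping_eqI)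
  fix c
  have "coeff (\<Sum>a\<in>A. monomial a (coeff p a)) c = (\<Sum>a\<in>A. if a = c then coeff p c else 0)"
    unfolding lookup_sum by (intro sum.cong) (auto simp: lookup_single when_def)
  also have "\<dots> = coeff p c"
    using assms by (auto simp: in_keys_iff)
  finally show "coeff (\<Sum>a\<in>A. monomial a (coeff p a)) c = coeff p c" .
qed

lemma mult_eq_sum_monomials:
  fixes p q :: "'a::comm_monoid_add \<Rightarrow>\<^sub>0 'k::comm_semiring_0"
  assumes "finite A" "supp p \<subseteq> A" "finite B" "supp q \<subseteq> B"
  shows "p * q = (\<Sum>a\<in>A. \<Sum>b\<in>B. monomial (a + b) (coeff p a * coeff q b))"
proof -
  have "p * q = (\<Sum>a\<in>A. monomial a (coeff p a)) * (\<Sum>b\<in>B. monomial b (coeff q b))"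
    by (simp add: sum_monomials assms)
  also have "\<dots> = (\<Sum>a\<in>A. \<Sum>b\<in>B. monomial (a + b) (coeff p a * coeff q b))"
    by (simp add: sum_product mult_single)
  finally show ?thesis .
qed

lemma supp_mult_subset:
  assumes "supp p \<subseteq> S" "supp q \<subseteq> S" "\<And>a b. a \<in> S \<Longrightarrow> b \<in> S \<Longrightarrow> a + b \<in> S"
  shows "supp (p * q) \<subseteq> S"
  using keys_mult[of p q] assms by blast

lemma supp_power_subset:
  fixes p :: "'a::comm_monoid_add \<Rightarrow>\<^sub>0 'k::comm_semiring_1"
  assumes "supp p \<subseteq> S" "0 \<in> S" "\<And>a b. a \<in> S \<Longrightarrow> b \<in> S \<Longrightarrow> a + b \<in> S"
  shows "supp (p ^ n) \<subseteq> S"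
proof (induction n)
  case 0
  show ?case using assms(2) by simp
next
  case (Suc n)
  show ?case using supp_mult_subset[OF assms(1) Suc assms(3)] by simp
qed

lemma supp_add_subset: "supp p \<subseteq> S \<Longrightarrow> supp q \<subseteq> S \<Longrightarrow> supp (p + q) \<subseteq> S"
  using keys_add[of p q] by blast

lemma supp_diff_subset:
  fixes p q :: "'a \<Rightarrow>\<^sub>0 'k::ab_group_add"
  assumes "supp p \<subseteq> S" "supp q \<subseteq> S"
  shows "supp (p - q) \<subseteq> S"
  using assms by (auto simp: subset_iff in_keys_iff lookup_minus) (metis diff_zero)

text \<open>
  An exponent of \<open>p * q\<close> that is a sum in only one way suffers no cancellation.
\<close>
lemma coeff_mult_unique:
  fixes p q :: "'a::comm_monoid_add \<Rightarrow>\<^sub>0 'k::comm_semiring_0"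
  assumes "a \<in> supp p" "b \<in> supp q"
    and "\<And>a' b'. a' \<in> supp p \<Longrightarrow> b' \<in> supp q \<Longrightarrow> a' + b' = a + b \<Longrightarrow> a' = a \<and> b' = b"
  shows "coeff (p * q) (a + b) = coeff p a * coeff q b"
proof -
  have "coeff (p * q) (a + b) =
     (\<Sum>a'\<in>supp p. \<Sum>b'\<in>supp q. coeff (monomial (a' + b') (coeff p a' * coeff q b')) (a + b))"
    by (subst mult_eq_sum_monomials[of "supp p" p "supp q" q]) (auto simp: lookup_sum)
  also have "\<dots> = (\<Sum>a'\<in>supp p. \<Sum>b'\<in>supp q. if a' = a then if b' = b then coeff p a * coeff q b else 0 else 0)"
    using assms(3) by (intro sum.cong refl) (auto simp: lookup_single when_def)
  also have "\<dots> = (\<Sum>a'\<in>supp p. if a' = a then coeff p a * coeff q b else 0)"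
    using assms by (intro sum.cong refl) auto
  also have "\<dots> = coeff p a * coeff q b"
    using assms by auto
  finally show ?thesis .
qed

definition restrict_supp :: "'a set \<Rightarrow> ('a \<Rightarrow>\<^sub>0 'b) \<Rightarrow> ('a \<Rightarrow>\<^sub>0 'b::zero)" where
  "restrict_supp S = Poly_Mapping.mapp (\<lambda>a c. if a \<in> S then c else 0)"

lemma coeff_restrict_supp: "coeff (restrict_supp S p) a = (if a \<in> S then coeff p a else 0)"
  by (auto simp: restrict_supp_def lookup_mapp when_def in_keys_iff)

lemma supp_restrict_supp: "supp (restrict_supp S p) = supp p \<inter> S"
  by (auto simp: in_keys_iff coeff_restrict_supp split: if_splits)

lemma restrict_supp_id: "supp p \<subseteq> S \<Longrightarrow> restrict_supp S p = p"
  by (rule poly_mapping_eqI) (auto simp: coeff_restrict_supp in_keys_iff)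

lemma restrict_supp_restrict_supp:
  "restrict_supp S (restrict_supp T p) = restrict_supp (S \<inter> T) p"
  by (rule poly_mapping_eqI) (auto simp: coeff_restrict_supp)

lemma restrict_supp_add: "restrict_supp S (p + q) = restrict_supp S p + restrict_supp S q"
  by (rule poly_mapping_eqI) (auto simp: coeff_restrict_supp lookup_add)

lemma restrict_supp_0: "restrict_supp S 0 = 0"
  by (rule poly_mapping_eqI) (auto simp: coeff_restrict_supp)

lemma restrict_supp_sum: "restrict_supp S (\<Sum>i\<in>I. f i) = (\<Sum>i\<in>I. restrict_supp S (f i))"
  by (rule poly_mapping_eqI) (auto simp: coeff_restrict_supp lookup_sum)

lemma restrict_supp_monomial:
  "restrict_supp S (monomial a c) = (if a \<in> S then monomial a c else 0)"
  by (rule poly_mapping_eqI) (auto simp: coeff_restrict_supp lookup_single when_def)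

lemma restrict_supp_mult_eq_sum:
  fixes p q :: "'a::comm_monoid_add \<Rightarrow>\<^sub>0 'k::comm_semiring_0"
  shows "restrict_supp S p * restrict_supp S q = (\<Sum>a\<in>supp p. \<Sum>b\<in>supp q.
    if a \<in> S \<and> b \<in> S then monomial (a + b) (coeff p a * coeff q b) else 0)"
proof -
  have "restrict_supp S p * restrict_supp S q = (\<Sum>a\<in>supp p. \<Sum>b\<in>supp q.
      monomial (a + b) (coeff (restrict_supp S p) a * coeff (restrict_supp S q) b))"
    by (rule mult_eq_sum_monomials) (simp_all add: supp_restrict_supp)
  also have "\<dots> = (\<Sum>a\<in>supp p. \<Sum>b\<in>supp q.
    if a \<in> S \<and> b \<in> S then monomial (a + b) (coeff p a * coeff q b) else 0)"
    by (intro sum.cong refl) (simp add: coeff_restrict_supp)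
  finally show ?thesis .
qed

lemma restrict_supp_mult:
  fixes p q :: "'a::comm_monoid_add \<Rightarrow>\<^sub>0 'k::comm_semiring_0"
  assumes "\<And>a b. a \<in> supp p \<Longrightarrow> b \<in> supp q \<Longrightarrow> a + b \<in> S \<longleftrightarrow> a \<in> S \<and> b \<in> S"
  shows "restrict_supp S (p * q) = restrict_supp S p * restrict_supp S q"
proof -
  have "restrict_supp S (p * q) = (\<Sum>a\<in>supp p. \<Sum>b\<in>supp q.
      restrict_supp S (monomial (a + b) (coeff p a * coeff q b)))"
    by (subst mult_eq_sum_monomials[OF finite_keys order_refl finite_keys order_refl])
      (simp add: restrict_supp_sum)
  also have "\<dots> = restrict_supp S p * restrict_supp S q"
    unfolding restrict_supp_mult_eq_sum
    by (intro sum.cong refl) (simp add: restrict_supp_monomial assms)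
  finally show ?thesis .
qed

section \<open>Leading exponents\<close>

text \<open>
  The exponents of \<open>p\<close> are compared by \<open>\<phi>\<close> first and by \<open>u\<close> in case of a tie. For linear \<open>\<phi>\<close> and
  injective linear \<open>u\<close> this is a total group order, so that leading exponents of products add up, and hence
  so do the maxima of an arbitrary, possibly degenerate, functional \<open>\<phi>\<close>. The order given by \<open>u\<close> alone is the case \<open>\<phi> = u\<close>.
\<close>
definition top_key :: "('a \<Rightarrow> real) \<Rightarrow> ('a \<Rightarrow> real) \<Rightarrow> ('a \<Rightarrow>\<^sub>0 'k::zero) \<Rightarrow> 'a \<Rightarrow> bool" where
  "top_key \<phi> u p a \<longleftrightarrow>
    a \<in> supp p \<and> (\<forall>b\<in>supp p. b \<noteq> a \<longrightarrow> \<phi> b < \<phi> a \<or> \<phi> b = \<phi> a \<and> u b < u a)"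

lemma top_key_exists:
  assumes "p \<noteq> 0" "inj_on u (supp p)"
  shows "\<exists>a. top_key \<phi> u p a"
proof -
  have ne: "supp p \<noteq> {}" using assms(1) by (metis lookup_zero poly_mapping_eqI in_keys_iff empty_iff)
  define T where "T = {a \<in> supp p. \<phi> a = Max (\<phi> ` supp p)}"
  have "Max (\<phi> ` supp p) \<in> \<phi> ` supp p"
    using ne by (intro Max_in) auto
  then have "T \<noteq> {}" by (auto simp: T_def)
  moreover have "finite T" by (auto simp: T_def)
  ultimately have "Max (u ` T) \<in> u ` T"
    by (intro Max_in) auto
  then obtain a where a: "a \<in> T" "u a = Max (u ` T)" by auto
  have "\<phi> b < \<phi> a \<or> \<phi> b = \<phi> a \<and> u b < u a" if b: "b \<in> supp p" "b \<noteq> a" for b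
  proof (cases "b \<in> T")
    case True
    then have "u b \<le> u a" using a(2) \<open>finite T\<close> by auto
    moreover have "u b \<noteq> u a"
      using assms(2) b a(1) by (auto simp: T_def inj_on_def)
    ultimately show ?thesis using True a(1) by (auto simp: T_def)
  next
    case False
    then have "\<phi> b \<le> \<phi> a" "\<phi> b \<noteq> \<phi> a"
      using b a(1) by (auto simp: T_def)
    then show ?thesis by auto
  qed
  then have "top_key \<phi> u p a" using a(1) by (simp add: top_key_def T_def)
  then show ?thesis ..
qed

lemma top_key_le:
  assumes "top_key \<phi> u p a" "b \<in> supp p"
  shows "\<phi> b \<le> \<phi> a"
  using assms by (cases "b = a") (auto simp: top_key_def)

lemma top_key_unique:
  assumes "top_key \<phi> u p a" "top_key \<phi> u p b"
  shows "a = b"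
  using assms unfolding top_key_def by (metis less_asym less_irrefl)

lemma top_key_mult:
  fixes p q :: "'g::real_vector \<Rightarrow>\<^sub>0 'k::field"
  assumes "linear \<phi>" "linear u"
    and p: "top_key \<phi> u p a" and q: "top_key \<phi> u q b"
  shows "top_key \<phi> u (p * q) (a + b)"
proof -
  interpret phi: linear \<phi> by fact
  interpret u: linear u by fact
  have lt: "\<phi> (a' + b') < \<phi> (a + b) \<or> \<phi> (a' + b') = \<phi> (a + b) \<and> u (a' + b') < u (a + b)"
    if "a' \<in> supp p" "b' \<in> supp q" "a' \<noteq> a \<or> b' \<noteq> b" for a' b'
    using that p q unfolding top_key_def phi.add u.add
    by (cases "a' = a"; cases "b' = b") (auto, (smt (verit))+)
  have "coeff (p * q) (a + b) = coeff p a * coeff q b"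
  proof (rule coeff_mult_unique)
    fix a' b' assume *: "a' \<in> supp p" "b' \<in> supp q" "a' + b' = a + b"
    show "a' = a \<and> b' = b" using lt[OF *(1,2)] *(3) by auto
  qed (use p q in \<open>auto simp: top_key_def\<close>)
  moreover have "coeff p a \<noteq> 0" "coeff q b \<noteq> 0"
    using p q by (auto simp: top_key_def in_keys_iff)
  ultimately have "a + b \<in> supp (p * q)"
    by (simp add: in_keys_iff)
  moreover have "\<phi> c < \<phi> (a + b) \<or> \<phi> c = \<phi> (a + b) \<and> u c < u (a + b)"
    if c: "c \<in> supp (p * q)" "c \<noteq> a + b" for c
  proof -
    obtain a' b' where "c = a' + b'" "a' \<in> supp p" "b' \<in> supp q"
      using keys_mult[of p q] c by blast
    then show ?thesis using lt[of a' b'] c(2) by auto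
  qed
  ultimately show ?thesis by (auto simp: top_key_def)
qed

lemma top_key_power:
  fixes p :: "'g::real_vector \<Rightarrow>\<^sub>0 'k::field"
  assumes "linear \<phi>" "linear u" "top_key \<phi> u p a"
  shows "top_key \<phi> u (p ^ n) (real n *\<^sub>R a)"
proof (induction n)
  case 0
  show ?case by (simp add: top_key_def)
next
  case (Suc n)
  show ?case using top_key_mult[OF assms Suc] by (simp add: algebra_simps)
qed

section \<open>Group algebras of lattices: square and cube roots\<close>

text \<open>
  An additive group \<open>G\<close> with the two features of a subgroup of \<open>\<int>\<^sup>n\<close> that the division
  algorithm below uses: a linear functional \<open>u\<close> that orders \<open>G\<close> totally, and a set \<open>\<Phi>\<close> of functionals
  (plus and minus the coordinates) such that upper bounds for all of them leave finitely many points.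
\<close>
locale lattice_subgroup =
  fixes G :: "'g::real_vector set" and u :: "'g \<Rightarrow> real" and \<Phi> :: "('g \<Rightarrow> real) set"
  assumes zero_mem: "0 \<in> G" and diff_mem: "\<And>a b. a \<in> G \<Longrightarrow> b \<in> G \<Longrightarrow> a - b \<in> G"
    and u: "linear u" "inj_on u G"
    and \<Phi>: "\<And>\<phi>. \<phi> \<in> \<Phi> \<Longrightarrow> linear \<phi>"
    and finite_box: "\<And>B. finite {a \<in> G. \<forall>\<phi>\<in>\<Phi>. \<phi> a \<le> B \<phi>}"
begin

lemma add_mem: "a \<in> G \<Longrightarrow> b \<in> G \<Longrightarrow> a + b \<in> G"
  using diff_mem[OF _ diff_mem[OF zero_mem]] by fastforce

lemma top_key_exists_G:
  assumes "p \<noteq> 0" "supp p \<subseteq> G"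
  obtains a where "top_key \<phi> u p a"
  using top_key_exists[of p u \<phi>] assms u(2) inj_on_subset by blast

lemma mult_neq_0:
  fixes p q :: "'g \<Rightarrow>\<^sub>0 'k::field"
  assumes "supp p \<subseteq> G" "supp q \<subseteq> G" "p \<noteq> 0" "q \<noteq> 0"
  shows "p * q \<noteq> 0"
proof -
  obtain a b where "top_key u u p a" "top_key u u q b"
    using top_key_exists_G assms by metis
  then have "top_key u u (p * q) (a + b)"
    using top_key_mult u by blast
  then show ?thesis by (auto simp: top_key_def)
qed

lemma mult_left_cancel_G:
  fixes p q r :: "'g \<Rightarrow>\<^sub>0 'k::field"
  assumes "supp p \<subseteq> G" "supp q \<subseteq> G" "supp r \<subseteq> G" "p \<noteq> 0" "p * q = p * r"
  shows "q = r"
  using mult_neq_0[of p "q - r"] assms supp_diff_subset[of q G r] by (auto simp: algebra_simps)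

lemma power_neq_0:
  fixes p :: "'g \<Rightarrow>\<^sub>0 'k::field"
  assumes "supp p \<subseteq> G" "p \<noteq> 0"
  shows "p ^ n \<noteq> 0"
proof (induction n)
  case 0
  show ?case by simp
next
  case (Suc n)
  show ?case
    using mult_neq_0[OF assms(1) supp_power_subset[OF assms(1) zero_mem add_mem] assms(2) Suc] by simp
qed

lemma square_cube_unique:
  fixes z z' :: "'g \<Rightarrow>\<^sub>0 'k::field"
  assumes "supp z \<subseteq> G" "supp z' \<subseteq> G" "z ^ 2 = z' ^ 2" "z ^ 3 = z' ^ 3"
  shows "z = z'"
proof (cases "z = 0")
  case True
  then show ?thesis using power_neq_0[of z' 2] assms by auto
next
  case False
  have "z ^ 2 * z = z ^ 2 * z'"
    using assms(3,4) by (simp add: power2_eq_square power3_eq_cube)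
  then show ?thesis
    using mult_left_cancel_G[of "z ^ 2" z z'] False assms power_neq_0[of z 2]
      supp_power_subset[of z G 2] zero_mem add_mem by blast
qed

text \<open>
  The minimum of \<open>\<phi>\<close> on the support of \<open>z\<^sup>2\<close> is twice its minimum on the support of \<open>z\<close>.
\<close>
lemma halfspace_if_square_halfspace:
  fixes z :: "'g \<Rightarrow>\<^sub>0 'k::field" and \<phi> :: "'g \<Rightarrow> real"
  assumes "supp z \<subseteq> G" "linear \<phi>" "\<And>a. a \<in> supp (z ^ 2) \<Longrightarrow> 0 \<le> \<phi> a" "a \<in> supp z"
  shows "0 \<le> \<phi> a"
proof -
  interpret phi: linear \<phi> by fact
  have lin: "linear (\<lambda>a. - \<phi> a)"
    by (rule linearI) (simp_all add: phi.add phi.scale)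
  have "z \<noteq> 0" using assms(4) by auto
  then obtain b where b: "top_key (\<lambda>a. - \<phi> a) u z b"
    using top_key_exists_G assms(1) by metis
  have "top_key (\<lambda>a. - \<phi> a) u (z ^ 2) (real 2 *\<^sub>R b)"
    by (rule top_key_power[OF lin u(1) b])
  then have "0 \<le> \<phi> (real 2 *\<^sub>R b)"
    using assms(3) by (simp add: top_key_def)
  then show ?thesis using top_key_le[OF b assms(4)] by (simp add: phi.scale)
qed

text \<open>
  For nonzero \<open>d\<close> and \<open>y\<close> this says, in the fraction field of \<open>k[G]\<close>, that \<open>d\<close> is a common denominator of all powers of \<open>p / y\<close>.
\<close>
definition almost_integral ::
    "('g \<Rightarrow>\<^sub>0 'k::field) \<Rightarrow> ('g \<Rightarrow>\<^sub>0 'k) \<Rightarrow> ('g \<Rightarrow>\<^sub>0 'k) \<Rightarrow> bool" where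
  "almost_integral d y p \<longleftrightarrow> (\<forall>n. \<exists>h. supp h \<subseteq> G \<and> d * p ^ n = y ^ n * h)"

text \<open>
  The exponent \<open>c - a\<close> of the quotient of the \<open>u\<close>-leading monomials of \<open>p\<close> and \<open>y\<close> would obviously obey this
  bound if \<open>y\<close> divided \<open>p\<close>. Almost integrality suffices: the quotient \<open>h\<close> of \<open>d * p\<^sup>n\<close> by \<open>y\<^sup>n\<close> has an exponent
  that differs from \<open>n (c - a)\<close> by a constant, its \<open>\<phi>\<close>-maximum differs from \<open>n (\<phi> c' - \<phi> a')\<close> by a constant,
  and the constants become negligible as \<open>n\<close> grows.
\<close>
lemma top_key_almost_integral:
  fixes d y p :: "'g \<Rightarrow>\<^sub>0 'k::field"
  assumes supp: "supp d \<subseteq> G" "supp y \<subseteq> G" "supp p \<subseteq> G" and nz: "d \<noteq> 0" "y \<noteq> 0"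
    and int: "almost_integral d y p" and \<phi>: "linear \<phi>"
    and tops: "top_key u u p c" "top_key u u y a" "top_key \<phi> u p c'" "top_key \<phi> u y a'"
  shows "\<phi> (c - a) \<le> \<phi> c' - \<phi> a'"
proof -
  interpret phi: linear \<phi> by fact
  obtain b where b: "top_key u u d b" using top_key_exists_G supp nz by metis
  obtain b' where b': "top_key \<phi> u d b'" using top_key_exists_G supp nz by metis
  have p0: "p \<noteq> 0" using tops(1) by (auto simp: top_key_def)
  have bound: "real n * (\<phi> (c - a) - (\<phi> c' - \<phi> a')) \<le> \<phi> b' - \<phi> b" for n
  proof -
    obtain h where h: "supp h \<subseteq> G" "d * p ^ n = y ^ n * h"
      using int by (auto simp: almost_integral_def)
    have "d * p ^ n \<noteq> 0"
      using supp nz p0 by (intro mult_neq_0 power_neq_0 supp_power_subset zero_mem add_mem) auto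
    then have h0: "h \<noteq> 0" using h(2) by auto
    obtain e where e: "top_key u u h e" using top_key_exists_G h h0 by metis
    obtain e' where e': "top_key \<phi> u h e'" using top_key_exists_G h h0 by metis
    have "top_key u u (d * p ^ n) (b + real n *\<^sub>R c)" "top_key u u (y ^ n * h) (real n *\<^sub>R a + e)"
      using top_key_mult top_key_power u b e tops by blast+
    then have 1: "b + real n *\<^sub>R c = real n *\<^sub>R a + e"
      using h(2) top_key_unique by metis
    have "top_key \<phi> u (d * p ^ n) (b' + real n *\<^sub>R c')" "top_key \<phi> u (y ^ n * h) (real n *\<^sub>R a' + e')"
      using top_key_mult top_key_power u \<phi> b' e' tops by blast+
    then have 2: "b' + real n *\<^sub>R c' = real n *\<^sub>R a' + e'"
      using h(2) top_key_unique by metis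
    have "e \<in> supp h" using e by (auto simp: top_key_def)
    then have "\<phi> e \<le> \<phi> e'" using top_key_le[OF e'] by auto
    moreover have "\<phi> b + real n * \<phi> c = real n * \<phi> a + \<phi> e"
      using arg_cong[OF 1, of \<phi>] by (simp add: phi.add phi.scale)
    moreover have "\<phi> b' + real n * \<phi> c' = real n * \<phi> a' + \<phi> e'"
      using arg_cong[OF 2, of \<phi>] by (simp add: phi.add phi.scale)
    ultimately show ?thesis by (simp add: phi.diff algebra_simps)
  qed
  show ?thesis
  proof (rule ccontr)
    assume "\<not> ?thesis"
    then have "0 < \<phi> (c - a) - (\<phi> c' - \<phi> a')" by simp
    from reals_Archimedean3[OF this] obtain n where
      "\<phi> b' - \<phi> b < real n * (\<phi> (c - a) - (\<phi> c' - \<phi> a'))" by blast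
    with bound[of n] show False by simp
  qed
qed

text \<open>
  In the binomial expansion of \<open>(p - y * s)\<^sup>n\<close>, the factor \<open>p\<^sup>i\<close> of a term supplies \<open>y\<^sup>i\<close> once it is multiplied
  by \<open>d\<close>, and the factor \<open>(y * s)\<^sup>n\<^sup>-\<^sup>i\<close> supplies the remaining powers of \<open>y\<close>.
\<close>
lemma almost_integral_diff:
  fixes d y p s :: "'g \<Rightarrow>\<^sub>0 'k::field"
  assumes "almost_integral d y p" "supp s \<subseteq> G"
  shows "almost_integral d y (p - y * s)"
  unfolding almost_integral_def
proof
  fix n
  obtain h where h: "\<And>i. supp (h i) \<subseteq> G" "\<And>i. d * p ^ i = y ^ i * h i"
    using assms(1) unfolding almost_integral_def by metis
  let ?t = "\<lambda>i. of_nat (n choose i) * (h i * (- s) ^ (n - i))"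
  have "d * (p - y * s) ^ n = d * (p + y * (- s)) ^ n" by simp
  also have "\<dots> = (\<Sum>i\<le>n. of_nat (n choose i) * (d * p ^ i) * (y * (- s)) ^ (n - i))"
    unfolding binomial_ring sum_distrib_left by (intro sum.cong) (auto simp: ac_simps)
  also have "\<dots> = (\<Sum>i\<le>n. y ^ n * ?t i)"
  proof (intro sum.cong refl)
    fix i assume "i \<in> {..n}"
    then have "y ^ n = y ^ i * y ^ (n - i)" by (simp flip: power_add)
    then show "of_nat (n choose i) * (d * p ^ i) * (y * (- s)) ^ (n - i) = y ^ n * ?t i"
      by (simp only: h(2) power_mult_distrib ac_simps)
  qed
  also have "\<dots> = y ^ n * (\<Sum>i\<le>n. ?t i)" by (simp add: sum_distrib_left)
  finally have eq: "d * (p - y * s) ^ n = y ^ n * (\<Sum>i\<le>n. ?t i)" .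
  have "supp (?t i) \<subseteq> G" for i
  proof -
    have "supp (of_nat (n choose i) :: 'g \<Rightarrow>\<^sub>0 'k) \<subseteq> G"
      using zero_mem by (metis empty_subsetI insert_subset keys_single single_of_nat)
    moreover have "supp (- s) \<subseteq> G"
      using assms(2) by (auto simp: in_keys_iff subset_iff)
    ultimately show ?thesis
      using h(1) by (intro supp_mult_subset supp_power_subset add_mem zero_mem) auto
  qed
  then have "supp (\<Sum>i\<le>n. ?t i) \<subseteq> G"
    using keys_sum[of ?t "{..n}"] by blast
  with eq show "\<exists>h. supp h \<subseteq> G \<and> d * (p - y * s) ^ n = y ^ n * h" by blast
qed

text \<open>
  Group algebras of lattices are completely integrally closed. Long division of \<open>p\<close> by \<open>y\<close>, leading
  terms first in the order of \<open>u\<close>, never produces a quotient exponent outside the finite set \<open>E\<close>; so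
  the number of points of \<open>E\<close> that are still available decreases with each step.
\<close>
lemma almost_integral_dvd:
  fixes d y p :: "'g \<Rightarrow>\<^sub>0 'k::field"
  assumes "supp d \<subseteq> G" "supp y \<subseteq> G" "supp p \<subseteq> G" "d \<noteq> 0" "y \<noteq> 0" "almost_integral d y p"
  shows "\<exists>s. supp s \<subseteq> G \<and> p = y * s"
proof -
  have "\<forall>\<phi>. \<exists>a. top_key \<phi> u y a" using top_key_exists_G[OF assms(5,2)] by metis
  then obtain a where a: "\<And>\<phi>. top_key \<phi> u y (a \<phi>)" by metis
  \<comment> \<open>Inserting 0 only loosens the bound, and gives it a value for \<open>p = 0\<close>.\<close>
  define B where "B \<phi> = Max (insert 0 (\<phi> ` supp p)) - \<phi> (a \<phi>)" for \<phi>
  define E where "E = {e \<in> G. \<forall>\<phi>\<in>\<Phi>. \<phi> e \<le> B \<phi>}"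
  define below where "below t = {e \<in> E. u e \<le> t}" for t
  have finE: "finite E" unfolding E_def by (rule finite_box)
  interpret u: linear u by (rule u)
  have "\<exists>s. supp s \<subseteq> G \<and> q = y * s"
    if "q \<noteq> 0" "supp q \<subseteq> G" "almost_integral d y q" "top_key u u q c"
      "\<forall>\<phi>\<in>\<Phi>. \<forall>b\<in>supp q. \<phi> b \<le> B \<phi> + \<phi> (a \<phi>)" for q c
    using that
  proof (induction "card (below (u c - u (a u)))" arbitrary: q c rule: less_induct)
    case less
    define e where "e = c - a u"
    have cq: "c \<in> supp q" and aG: "a u \<in> supp y"
      using less.prems(4) a[of u] by (auto simp: top_key_def)
    have eG: "e \<in> G" using cq aG less.prems assms unfolding e_def by (intro diff_mem) auto
    have e\<phi>: "\<phi> e \<le> B \<phi>" if \<phi>: "\<phi> \<in> \<Phi>" for \<phi>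
    proof -
      obtain c' where c': "top_key \<phi> u q c'" using top_key_exists_G less.prems by metis
      have "\<phi> e \<le> \<phi> c' - \<phi> (a \<phi>)"
        unfolding e_def
        by (rule top_key_almost_integral[OF assms(1,2) less.prems(2) assms(4,5) less.prems(3)
              \<Phi>[OF \<phi>] less.prems(4) a c' a])
      moreover have "c' \<in> supp q" using c' by (auto simp: top_key_def)
      ultimately show ?thesis using less.prems(5) \<phi> by fastforce
    qed
    have eE: "e \<in> E" using eG e\<phi> by (auto simp: E_def)
    \<comment> \<open>One step of the division: \<open>m\<close> is the quotient of the leading monomials.\<close>
    define m where "m = monomial e (coeff q c / coeff y (a u))"
    have suppm: "supp m \<subseteq> {e}" by (auto simp: m_def)
    have mG: "supp m \<subseteq> G" using suppm eG by auto
    define q' where "q' = q - y * m"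
    have ymG: "supp (y * m) \<subseteq> G"
      using assms mG by (intro supp_mult_subset add_mem)
    have q'G: "supp q' \<subseteq> G"
      using less.prems ymG unfolding q'_def by (intro supp_diff_subset)
    have ym: "\<exists>b'\<in>supp y. b = b' + e" if "b \<in> supp (y * m)" for b
      using that keys_mult[of y m] suppm by blast
    have supp_q': "b \<in> supp q \<or> b \<in> supp (y * m)" if "b \<in> supp q'" for b
      using that by (auto simp: q'_def in_keys_iff lookup_minus)
    have int': "almost_integral d y q'"
      unfolding q'_def by (rule almost_integral_diff[OF less.prems(3) mG])
    have bound': "\<forall>\<phi>\<in>\<Phi>. \<forall>b\<in>supp q'. \<phi> b \<le> B \<phi> + \<phi> (a \<phi>)"
    proof (intro ballI)
      fix \<phi> b assume *: "\<phi> \<in> \<Phi>" "b \<in> supp q'"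
      interpret phi: linear \<phi> using \<Phi> * by blast
      show "\<phi> b \<le> B \<phi> + \<phi> (a \<phi>)"
        using supp_q'[OF *(2)]
      proof
        assume "b \<in> supp q" then show ?thesis using less.prems(5) * by blast
      next
        assume "b \<in> supp (y * m)"
        then obtain b' where "b' \<in> supp y" "b = b' + e" using ym by blast
        then show ?thesis using top_key_le[OF a[of \<phi>]] e\<phi>[OF *(1)] by (fastforce simp: phi.add)
      qed
    qed
    show ?case
    proof (cases "q' = 0")
      case True
      then show ?thesis using mG unfolding q'_def by (intro exI[of _ m]) auto
    next
      case False
      obtain c' where c': "top_key u u q' c'" using top_key_exists_G q'G False by metis
      have c'q: "c' \<in> supp q'" using c' by (auto simp: top_key_def)
      have cancel: "coeff q' c = 0"
      proof -
        have "top_key u u m e"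
          using cq aG suppm by (auto simp: top_key_def m_def in_keys_iff)
        then have "coeff (y * m) (a u + e) = coeff y (a u) * coeff m e"
          using suppm aG by (intro coeff_mult_unique) (auto simp: top_key_def)
        then show ?thesis
          using aG by (simp add: q'_def lookup_minus e_def m_def in_keys_iff)
      qed
      have "u c' \<le> u c"
        using supp_q'[OF c'q]
      proof
        assume "c' \<in> supp q" then show ?thesis using top_key_le less.prems(4) by metis
      next
        assume "c' \<in> supp (y * m)"
        then obtain b' where "b' \<in> supp y" "c' = b' + e" using ym by blast
        then show ?thesis using top_key_le[OF a[of u]] by (fastforce simp: u.add u.diff e_def)
      qed
      moreover have "c' \<noteq> c" using c'q cancel by (auto simp: in_keys_iff)
      then have "u c' \<noteq> u c"
        using u(2) c'q cq q'G less.prems(2) by (auto simp: inj_on_def)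
      ultimately have "u c' < u c" by simp
      then have "below (u c' - u (a u)) \<subseteq> below (u c - u (a u))"
        "e \<notin> below (u c' - u (a u))" "e \<in> below (u c - u (a u))"
        using eE by (auto simp: below_def e_def u.diff)
      then have "below (u c' - u (a u)) \<subset> below (u c - u (a u))" by blast
      moreover have "finite (below (u c - u (a u)))" using finE by (auto simp: below_def)
      ultimately have "card (below (u c' - u (a u))) < card (below (u c - u (a u)))"
        by (simp add: psubset_card_mono)
      from less.hyps[OF this False q'G int' c' bound'] obtain s where
        s: "supp s \<subseteq> G" "q' = y * s" by blast
      have "q = y * (s + m)" using s(2) by (simp add: q'_def algebra_simps)
      moreover have "supp (s + m) \<subseteq> G" using keys_add[of s m] s mG by auto
      ultimately show ?thesis by blast
    qed
  qed
  moreover have "\<phi> b \<le> B \<phi> + \<phi> (a \<phi>)" if "b \<in> supp p" for \<phi> b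
    using that by (simp add: B_def)
  moreover have "\<exists>c. top_key u u p c" if "p \<noteq> 0"
    using top_key_exists_G that assms by metis
  ultimately show ?thesis
    using assms by (cases "p = 0") (auto intro: exI[of _ 0])
qed

text \<open>
  If \<open>y \<noteq> 0\<close>, then \<open>f = x / y\<close> satisfies \<open>f\<^sup>2 = y\<close> and \<open>f\<^sup>3 = x\<close>, so all powers of \<open>f\<close> except perhaps \<open>f\<close> itself lie in \<open>k[G]\<close>,
  and \<open>y\<close> is a common denominator for them.
\<close>
lemma square_cube_root:
  fixes x y :: "'g \<Rightarrow>\<^sub>0 'k::field"
  assumes "supp x \<subseteq> G" "supp y \<subseteq> G" "x ^ 2 = y ^ 3"
  obtains z where "supp z \<subseteq> G" "x = z ^ 3" "y = z ^ 2"
proof (cases "y = 0")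
  case True
  then have "x = 0" using power_neq_0[of x 2] assms by auto
  with True that[of 0] show ?thesis by auto
next
  case False
  have "almost_integral y y x"
    unfolding almost_integral_def
  proof
    fix n :: nat
    obtain m where "n = 2 * m \<or> n = 2 * m + 1" by (meson oddE evenE)
    then show "\<exists>h. supp h \<subseteq> G \<and> y * x ^ n = y ^ n * h"
    proof
      assume n: "n = 2 * m"
      have "y * x ^ n = y * (x ^ 2) ^ m" by (simp add: n power_mult)
      also have "\<dots> = y ^ n * y ^ (m + 1)"
        unfolding assms(3) by (simp add: n flip: power_mult power_add power_Suc)
      finally show ?thesis
        using supp_power_subset[OF assms(2) zero_mem add_mem] by blast
    next
      assume n: "n = 2 * m + 1"
      have "y * x ^ n = y * (x ^ 2) ^ m * x" by (simp add: n power_mult)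
      also have "\<dots> = y ^ n * (y ^ m * x)"
        unfolding assms(3) by (simp add: n flip: power_mult power_add power_Suc mult.assoc)
      finally show ?thesis
        using supp_mult_subset[OF supp_power_subset[OF assms(2) zero_mem add_mem] assms(1) add_mem]
        by blast
    qed
  qed
  from almost_integral_dvd[OF assms(2,2,1) False False this]
  obtain z where z: "supp z \<subseteq> G" "x = y * z" by blast
  have "y ^ 2 * z ^ 2 = y ^ 2 * y"
    using assms(3) by (simp add: z(2) power2_eq_square power3_eq_cube ac_simps)
  then have "z ^ 2 = y"
    using mult_left_cancel_G[of "y ^ 2" "z ^ 2" y] power_neq_0[OF assms(2) False, of 2]
      supp_power_subset[OF assms(2) zero_mem add_mem] supp_power_subset[OF z(1) zero_mem add_mem] assms(2)
    by blast
  moreover have "x = z ^ 3"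
    unfolding z(2) \<open>z ^ 2 = y\<close>[symmetric] by (simp add: power2_eq_square power3_eq_cube)
  ultimately show ?thesis using that[OF z(1)] by simp
qed

end

section \<open>Subgroups of the integer lattice\<close>

text \<open>
  The functionals that vanish at a given nonzero vector form a null set, and the lattice is countable.
\<close>
lemma generic_linear_functional:
  obtains u :: "real ^ 'n \<Rightarrow> real" where "linear u" "inj_on u int_lattice"
proof -
  have "int_lattice \<subseteq> range (\<lambda>f :: 'n \<Rightarrow> int. \<chi> i. real_of_int (f i))"
  proof
    fix x :: "real ^ 'n" assume "x \<in> int_lattice"
    then have "x = (\<chi> i. real_of_int \<lfloor>x $ i\<rfloor>)"
      by (simp add: int_lattice_def vec_eq_iff)
    then show "x \<in> range (\<lambda>f :: 'n \<Rightarrow> int. \<chi> i. real_of_int (f i))"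
      by (rule range_eqI[of _ _ "\<lambda>i. \<lfloor>x $ i\<rfloor>"])
  qed
  then have cnt: "countable (int_lattice :: (real ^ 'n) set)"
    by (rule countable_subset) simp
  define H where "H a = {x :: real ^ 'n. a \<bullet> x = 0}" for a
  have "negligible (\<Union> (H ` (int_lattice - {0})))"
    using cnt by (intro negligible_countable_Union) (auto simp: H_def intro!: negligible_hyperplane)
  then have "\<Union> (H ` (int_lattice - {0})) \<noteq> UNIV"
    using non_negligible_UNIV by metis
  then obtain w where "w \<notin> \<Union> (H ` (int_lattice - {0}))" by (metis UNIV_eq_I)
  then have w: "a \<bullet> w \<noteq> 0" if "a \<in> int_lattice" "a \<noteq> 0" for a
    using that by (simp add: H_def)
  have "inj_on (\<lambda>x. x \<bullet> w) int_lattice"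
  proof (rule inj_onI)
    fix x y :: "real ^ 'n" assume *: "x \<in> int_lattice" "y \<in> int_lattice" "x \<bullet> w = y \<bullet> w"
    then have "x - y \<in> int_lattice" "(x - y) \<bullet> w = 0"
      by (simp_all add: int_lattice_def inner_diff_left)
    then show "x = y" using w[of "x - y"] eq_iff_diff_eq_0 by blast
  qed
  then show ?thesis
    by (intro that[of "\<lambda>x. x \<bullet> w"] bounded_linear.linear[OF bounded_linear_inner_left])
qed

lemma finite_int_lattice_box:
  fixes l h :: "'n::finite \<Rightarrow> real"
  shows "finite {x :: real ^ 'n. x \<in> int_lattice \<and> (\<forall>i. l i \<le> x $ i \<and> x $ i \<le> h i)}"
proof -
  define S where "S i = {t :: real. t \<in> \<int> \<and> l i \<le> t \<and> t \<le> h i}" for i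
  have "finite (PiE UNIV S)"
    by (intro finite_PiE) (auto simp: S_def finite_int_segment)
  then have fin: "finite ((\<lambda>f. \<chi> i. f i) ` PiE UNIV S)" by blast
  have "x \<in> (\<lambda>f. \<chi> i. f i) ` PiE UNIV S"
    if "x \<in> int_lattice" "\<forall>i. l i \<le> x $ i \<and> x $ i \<le> h i" for x
    using that by (intro image_eqI[of _ _ "vec_nth x"]) (auto simp: S_def int_lattice_def)
  then have "{x. x \<in> int_lattice \<and> (\<forall>i. l i \<le> x $ i \<and> x $ i \<le> h i)} \<subseteq> (\<lambda>f. \<chi> i. f i) ` PiE UNIV S"
    by blast
  then show ?thesis by (rule finite_subset[OF _ fin])
qed

lemma lattice_subgroup_int_lattice:
  fixes G :: "(real ^ 'n) set"
  assumes "G \<subseteq> int_lattice" "0 \<in> G" "\<And>a b. a \<in> G \<Longrightarrow> b \<in> G \<Longrightarrow> a - b \<in> G"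
  obtains u \<Phi> where "lattice_subgroup G u \<Phi>"
proof -
  obtain u :: "real ^ 'n \<Rightarrow> real" where u: "linear u" "inj_on u int_lattice"
    by (rule generic_linear_functional)
  let ?\<Phi> = "(\<Union>i. {\<lambda>x :: real ^ 'n. x $ i, \<lambda>x. - (x $ i)})"
  have "lattice_subgroup G u ?\<Phi>"
  proof (rule lattice_subgroup.intro)
    show "inj_on u G" using u(2) assms(1) inj_on_subset by blast
    show "linear \<phi>" if "\<phi> \<in> ?\<Phi>" for \<phi>
      using that by (auto intro!: linearI simp: algebra_simps)
    show "finite {a \<in> G. \<forall>\<phi>\<in>?\<Phi>. \<phi> a \<le> B \<phi>}" for B
    proof (rule finite_subset)
      show "finite {x :: real ^ 'n. x \<in> int_lattice \<and>
          (\<forall>i. - B (\<lambda>x. - (x $ i)) \<le> x $ i \<and> x $ i \<le> B (\<lambda>x. x $ i))}"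
        by (rule finite_int_lattice_box)
      show "{a \<in> G. \<forall>\<phi>\<in>?\<Phi>. \<phi> a \<le> B \<phi>} \<subseteq> {x \<in> int_lattice.
          (\<forall>i. - B (\<lambda>x. - (x $ i)) \<le> x $ i \<and> x $ i \<le> B (\<lambda>x. x $ i))}"
      proof (intro subsetI CollectI conjI allI)
        fix a i assume a: "a \<in> {a \<in> G. \<forall>\<phi>\<in>?\<Phi>. \<phi> a \<le> B \<phi>}"
        show "a \<in> int_lattice" using a assms(1) by auto
        have "- (a $ i) \<le> B (\<lambda>x. - (x $ i))" using a by auto
        then show "- B (\<lambda>x. - (x $ i)) \<le> a $ i" by simp
        show "a $ i \<le> B (\<lambda>x. x $ i)" using a by auto
      qed
    qed
  qed (use assms u in auto)
  then show ?thesis by (rule that)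
qed

lemma group_closure_subset:
  assumes "S \<subseteq> G" "0 \<in> G" "\<And>a b. a \<in> G \<Longrightarrow> b \<in> G \<Longrightarrow> a - b \<in> G"
  shows "group_closure S \<subseteq> G"
proof
  fix x assume "x \<in> group_closure S"
  then show "x \<in> G" by induction (use assms in auto)
qed

lemma int_lattice_diff: "a \<in> int_lattice \<Longrightarrow> b \<in> int_lattice \<Longrightarrow> a - b \<in> int_lattice"
  by (simp add: int_lattice_def)

lemma zero_in_int_lattice: "0 \<in> int_lattice"
  by (simp add: int_lattice_def)

lemma lattice_subgroup_group_closure:
  fixes S :: "(real ^ 'n) set"
  assumes "S \<subseteq> int_lattice"
  obtains u \<Phi> where "lattice_subgroup (group_closure S) u \<Phi>"
proof -
  have "group_closure S \<subseteq> int_lattice"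
    by (rule group_closure_subset[OF assms zero_in_int_lattice int_lattice_diff])
  from lattice_subgroup_int_lattice[OF this zero_in_group_closure group_closure.diff] that
  show ?thesis by metis
qed

section \<open>Submonoids of the integer lattice\<close>

lemma additive_submonoid_add:
  "additive_submonoid M \<Longrightarrow> a \<in> M \<Longrightarrow> b \<in> M \<Longrightarrow> a + b \<in> M"
  by (simp add: additive_submonoid_def)

lemma additive_submonoid_zero: "additive_submonoid M \<Longrightarrow> 0 \<in> M"
  by (simp add: additive_submonoid_def)

lemma additive_submonoid_scale:
  fixes M :: "'a::real_vector set"
  assumes "additive_submonoid M" "a \<in> M"
  shows "real n *\<^sub>R a \<in> M"
proof (induction n)
  case 0
  show ?case using additive_submonoid_zero[OF assms(1)] by simp
next
  case (Suc n)
  then show ?case using additive_submonoid_add[OF assms Suc] by (simp add: algebra_simps)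
qed

lemma additive_submonoid_sum:
  "additive_submonoid M \<Longrightarrow> (\<And>i. i \<in> I \<Longrightarrow> f i \<in> M) \<Longrightarrow> (\<Sum>i\<in>I. f i) \<in> M"
  by (induction I rule: infinite_finite_induct)
    (auto simp: additive_submonoid_zero additive_submonoid_add)

lemma group_closure_submonoid:
  fixes S :: "'a::ab_group_add set"
  assumes "additive_submonoid S" "x \<in> group_closure S"
  obtains a b where "a \<in> S" "b \<in> S" "x = a - b"
proof -
  have "\<exists>a\<in>S. \<exists>b\<in>S. x = a - b"
    using assms(2)
  proof induction
    case (base s)
    then show ?case using additive_submonoid_zero[OF assms(1)]
      by (intro bexI[of _ s] bexI[of _ 0]) auto
  next
    case (diff s t)
    then obtain a b c d where "a \<in> S" "b \<in> S" "c \<in> S" "d \<in> S" "s = a - b" "t = c - d" by blast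
    then show ?case using additive_submonoid_add[OF assms(1)]
      by (intro bexI[of _ "a + d"] bexI[of _ "b + c"]) auto
  qed
  then show ?thesis using that by blast
qed

text \<open>
  A lattice point in the real cone over \<open>M\<close> is a combination of elements of \<open>M\<close> even with nonnegative
  rational coefficients, which scaling makes integral. Instead of solving linear equations over \<open>\<rat>\<close>, approximate the given real
  coefficients simultaneously by fractions with a common denominator \<open>q\<close>. If the error is small
  enough, the resulting integral combination of the generators differs from \<open>q a\<close> by a lattice vector
  of norm below 1, which is 0.
\<close>
lemma multiple_of_cone_lattice_point:
  fixes M :: "(real ^ 'n) set"
  assumes M: "additive_submonoid M" "M \<subseteq> int_lattice"
    and a: "a \<in> nonneg_combinations M" "a \<in> int_lattice"
  obtains k :: nat where "k > 0" "real k *\<^sub>R a \<in> M"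
proof -
  obtain F c where F: "finite F" "F \<subseteq> M" "\<And>m. m \<in> F \<Longrightarrow> 0 \<le> c m" "a = (\<Sum>m\<in>F. c m *\<^sub>R m)"
    using a(1) by (auto simp: nonneg_combinations_def)
  obtain f and n :: nat where f: "bij_betw f {..<n} F"
    using ex_bij_betw_nat_finite[OF F(1)] by (metis atLeast0LessThan)
  obtain N :: nat where N: "(\<Sum>m\<in>F. norm m) + 1 < real N"
    using reals_Archimedean2 by blast
  moreover have "0 \<le> (\<Sum>m\<in>F. norm m)" by (intro sum_nonneg) auto
  ultimately have N0: "N > 0" by (cases N) auto
  obtain q p where qp: "0 < q"
      "\<And>i. i < n \<Longrightarrow> \<bar>of_int q * c (f i) - of_int (p i)\<bar> < 1 / N"
    using Dirichlet_approx_simult[OF N0, of n "\<lambda>i. c (f i)"] by metis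
  \<comment> \<open>Dirichlet's theorem numbers the coefficients; index the numerators by generators again.\<close>
  define r where "r = p \<circ> the_inv_into {..<n} f"
  have r: "\<bar>of_int q * c m - of_int (r m)\<bar> < 1 / N" if "m \<in> F" for m
  proof -
    have "m \<in> f ` {..<n}" using bij_betw_imp_surj_on[OF f] that by simp
    then obtain i where "i < n" "m = f i" by blast
    moreover from this have "the_inv_into {..<n} f m = i"
      using f by (simp add: bij_betw_def the_inv_into_f_f)
    ultimately show ?thesis
      using qp(2)[of i] by (simp add: r_def)
  qed
  have r0: "0 \<le> r m" if "m \<in> F" for m
  proof -
    have "0 \<le> of_int q * c m" using qp(1) F(3)[OF that] by simp
    moreover have "1 / real N \<le> 1" using N0 by simp
    ultimately have "- 1 < real_of_int (r m)" using r[OF that] by linarith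
    then show ?thesis by linarith
  qed
  define b where "b = real_of_int q *\<^sub>R a - (\<Sum>m\<in>F. of_int (r m) *\<^sub>R m)"
  have b_eq: "b = (\<Sum>m\<in>F. (of_int q * c m - of_int (r m)) *\<^sub>R m)"
    by (simp add: b_def F(4) scaleR_sum_right scaleR_left_diff_distrib sum_subtractf)
  have "norm b \<le> (\<Sum>m\<in>F. \<bar>of_int q * c m - of_int (r m)\<bar> * norm m)"
    unfolding b_eq by (rule order_trans[OF norm_sum]) simp
  also have "\<dots> \<le> (\<Sum>m\<in>F. 1 / real N * norm m)"
    using r by (intro sum_mono mult_right_mono) (auto intro: less_imp_le)
  also have "\<dots> = (\<Sum>m\<in>F. norm m) / real N" by (simp add: sum_divide_distrib)
  also have "\<dots> < 1" using N N0 by simp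
  finally have norm_b: "norm b < 1" .
  have "b $ i = 0" for i
  proof -
    have "m $ i \<in> \<int>" if "m \<in> F" for m using that F(2) M(2) by (auto simp: int_lattice_def)
    then have "b $ i \<in> \<int>"
      using a(2) by (auto simp: b_def int_lattice_def intro!: Ints_diff Ints_mult Ints_sum)
    moreover have "\<bar>b $ i\<bar> < 1" using component_le_norm_cart[of b i] norm_b by linarith
    ultimately show ?thesis by (simp add: Ints_nonzero_abs_less1)
  qed
  then have "b = 0" by (simp add: vec_eq_iff)
  then have "real (nat q) *\<^sub>R a = (\<Sum>m\<in>F. real (nat (r m)) *\<^sub>R m)"
    using r0 qp(1) by (simp add: b_def cong: sum.cong)
  also have "\<dots> \<in> M"
    using M(1) F(2) by (intro additive_submonoid_sum additive_submonoid_scale) auto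
  finally show ?thesis using qp(1) that[of "nat q"] by simp
qed

text \<open>
  If all multiples of \<open>x\<close> from the \<open>n + 1\<close>st on are in \<open>M\<close> and \<open>n > 0\<close>, then \<open>2 n x\<close> and \<open>3 n x\<close> are among them, so
  \<open>n x\<close> is in \<open>M\<close> as well.
\<close>
lemma seminormal_monoid_eventually:
  assumes M: "additive_submonoid M" "seminormal_monoid M" and x: "x \<in> group_closure M"
    and K: "\<And>k. k \<ge> K \<Longrightarrow> real k *\<^sub>R x \<in> M"
  shows "x \<in> M"
proof -
  have gc: "real k *\<^sub>R x \<in> group_closure M" for k
  proof (induction k)
    case (Suc k)
    then show ?case using group_closure_add[OF x Suc] by (simp add: algebra_simps)
  qed simp
  have "\<forall>k \<ge> Suc 0. real k *\<^sub>R x \<in> M" if "\<forall>k \<ge> Suc n. real k *\<^sub>R x \<in> M" for n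
    using that
  proof (induction n)
    case (Suc n)
    have "2 *\<^sub>R (real (Suc n) *\<^sub>R x) \<in> M"
      using Suc.prems[rule_format, of "2 * Suc n"] by simp
    moreover have "3 *\<^sub>R (real (Suc n) *\<^sub>R x) \<in> M"
      using Suc.prems[rule_format, of "3 * Suc n"] by simp
    ultimately have "real (Suc n) *\<^sub>R x \<in> M"
      using M(2) gc[of "Suc n"] unfolding seminormal_monoid_def by blast
    then have "\<forall>k \<ge> Suc n. real k *\<^sub>R x \<in> M"
      using Suc.prems by (metis le_eq_less_or_eq Suc_leI)
    then show ?case by (rule Suc.IH)
  qed simp
  from this[of K] K have "real (Suc 0) *\<^sub>R x \<in> M" by (meson le_Suc_eq order_refl Suc_leD)
  then show ?thesis by simp
qed

text \<open>
  The last hypothesis says that \<open>a\<close> is interior enough to absorb \<open>m2\<close>. A multiple \<open>k a\<close> with \<open>k = q N + j\<close>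
  and \<open>j \<le> q\<close> is \<open>j m1 - j m2 + q N a\<close>, and \<open>j\<close> of the \<open>q\<close> summands \<open>N a\<close> absorb the \<open>- j m2\<close>. For \<open>k \<ge> N\<^sup>2\<close>
  division with remainder yields such \<open>q\<close> and \<open>j\<close>.
\<close>
lemma seminormal_monoid_interior:
  assumes M: "additive_submonoid M" "seminormal_monoid M"
    and a: "m1 \<in> M" "m2 \<in> M" "a = m1 - m2" "real N *\<^sub>R a - m2 \<in> M"
  shows "a \<in> M"
proof (rule seminormal_monoid_eventually[OF M])
  show "a \<in> group_closure M"
    unfolding a(3) using a(1,2) by (intro group_closure.diff group_closure.base) auto
  show "real k *\<^sub>R a \<in> M" if k: "k \<ge> N * N" for k
  proof (cases "N = 0")
    case True
    \<comment> \<open>In this degenerate case \<open>m2\<close> is invertible in \<open>M\<close>.\<close>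
    have "- m2 \<in> M" using a(4) True by simp
    then have "a \<in> M" using additive_submonoid_add[OF M(1) a(1)] a(3) by fastforce
    then show ?thesis by (rule additive_submonoid_scale[OF M(1)])
  next
    case False
    define q j where "q = k div N" and "j = k mod N"
    have kq: "k = q * N + j" by (simp add: q_def j_def)
    have jq: "j \<le> q"
    proof -
      have "j < N" using False by (simp add: j_def)
      moreover have "N \<le> q" using k False by (simp add: q_def less_eq_div_iff_mult_less_eq)
      ultimately show ?thesis by simp
    qed
    have Na: "real N *\<^sub>R a \<in> M"
      using additive_submonoid_add[OF M(1) a(4,2)] by simp
    have "real k *\<^sub>R a = real j *\<^sub>R m1 + (real j *\<^sub>R (real N *\<^sub>R a - m2) + real (q - j) *\<^sub>R (real N *\<^sub>R a))"
      using jq by (simp add: kq a(3) algebra_simps of_nat_diff)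
    then show ?thesis
      using additive_submonoid_add[OF M(1) additive_submonoid_scale[OF M(1) a(1)]
          additive_submonoid_add[OF M(1) additive_submonoid_scale[OF M(1) a(4)]
            additive_submonoid_scale[OF M(1) Na]]]
      by metis
  qed
qed

section \<open>Roots with support in a seminormal monoid\<close>

text \<open>
  Faces enter only through their lattice points, in a form that needs no relative interiors: the
  smallest face of the saturation of \<open>M\<close> containing \<open>a\<close> consists of the points a positive multiple of
  which is in \<open>M\<close> and is a summand, within \<open>M\<close>, of a multiple of \<open>a\<close>.
\<close>
lemma seminormal_monoid_root_closed:
  fixes M :: "(real ^ 'n) set" and z :: "real ^ 'n \<Rightarrow>\<^sub>0 'k::field"
  assumes M: "additive_submonoid M" "M \<subseteq> int_lattice" "seminormal_monoid M"
    and cone: "rational_cone (nonneg_combinations M)"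
    and z: "supp z \<subseteq> group_closure M" "supp (z ^ 2) \<subseteq> M" "supp (z ^ 3) \<subseteq> M"
  shows "supp z \<subseteq> M"
proof
  fix a assume a: "a \<in> supp z"
  note add = additive_submonoid_add[OF M(1)] and scale = additive_submonoid_scale[OF M(1)]
    and zero = additive_submonoid_zero[OF M(1)]
  have gp: "group_closure M \<subseteq> int_lattice"
    by (rule group_closure_subset[OF M(2) zero_in_int_lattice int_lattice_diff])
  obtain u \<Phi> where "lattice_subgroup (group_closure M) u \<Phi>"
    using lattice_subgroup_group_closure[OF M(2)] by metis
  then interpret L: lattice_subgroup "group_closure M" u \<Phi> .
  obtain A where A: "nonneg_combinations M = {x. \<forall>a\<in>A. 0 \<le> a \<bullet> x}"
    using cone by (auto simp: rational_cone_def)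
  have M_cone: "m \<in> nonneg_combinations M" if "m \<in> M" for m
    unfolding nonneg_combinations_def using that
    by (intro CollectI exI[of _ "{m}"] exI[of _ "\<lambda>_. 1"]) auto
  have supp_cone: "b \<in> nonneg_combinations M" if b: "b \<in> supp z" for b
  proof -
    have "0 \<le> c \<bullet> b" if c: "c \<in> A" for c
    proof (rule L.halfspace_if_square_halfspace[OF z(1) _ _ b])
      show "linear (\<lambda>x. c \<bullet> x)" by (rule bounded_linear.linear[OF bounded_linear_inner_right])
      show "0 \<le> c \<bullet> x" if "x \<in> supp (z ^ 2)" for x
        using M_cone[of x] that z(2) c unfolding A by blast
    qed
    then show ?thesis unfolding A by blast
  qed
  have multiple: "\<exists>k>0. real k *\<^sub>R b \<in> M" if b: "b \<in> supp z" for b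
  proof -
    have "b \<in> int_lattice" using b z(1) gp by blast
    from multiple_of_cone_lattice_point[OF M(1,2) supp_cone[OF b] this]
    show ?thesis by metis
  qed
  \<comment> \<open>\<open>S\<close> is the face of \<open>a\<close> and \<open>sat\<close> the saturation, in both cases without the condition to lie in the group.\<close>
  define S where "S = {b. \<exists>k N. k > 0 \<and> real k *\<^sub>R b \<in> M \<and> real N *\<^sub>R a - real k *\<^sub>R b \<in> M}"
  define sat where "sat = {b. \<exists>k>0. real k *\<^sub>R b \<in> M}"
  have sat_add: "b + c \<in> sat" if bc: "b \<in> sat" "c \<in> sat" for b c
  proof -
    obtain k l where kl: "k > 0" "real k *\<^sub>R b \<in> M" "l > 0" "real l *\<^sub>R c \<in> M"
      using bc by (auto simp: sat_def)
    have "real (k * l) *\<^sub>R (b + c) = real l *\<^sub>R (real k *\<^sub>R b) + real k *\<^sub>R (real l *\<^sub>R c)"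
      by (simp add: algebra_simps)
    also have "\<dots> \<in> M" by (intro add scale kl)
    finally show ?thesis using kl(1,3) unfolding sat_def by (intro CollectI exI[of _ "k * l"]) simp
  qed
  \<comment> \<open>The face property, which makes restriction to \<open>S\<close> multiplicative.\<close>
  have face: "b + c \<in> S \<longleftrightarrow> b \<in> S \<and> c \<in> S" if bc: "b \<in> sat" "c \<in> sat" for b c
  proof
    assume "b \<in> S \<and> c \<in> S"
    then obtain k N l N' where
      b: "k > 0" "real k *\<^sub>R b \<in> M" "real N *\<^sub>R a - real k *\<^sub>R b \<in> M" and
      c: "l > 0" "real l *\<^sub>R c \<in> M" "real N' *\<^sub>R a - real l *\<^sub>R c \<in> M"
      by (auto simp: S_def)
    have "real (k * l) *\<^sub>R (b + c) = real l *\<^sub>R (real k *\<^sub>R b) + real k *\<^sub>R (real l *\<^sub>R c)"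
      by (simp add: algebra_simps)
    also have "\<dots> \<in> M" by (intro add scale b c)
    finally have 1: "real (k * l) *\<^sub>R (b + c) \<in> M" .
    have "real (l * N + k * N') *\<^sub>R a - real (k * l) *\<^sub>R (b + c) =
        real l *\<^sub>R (real N *\<^sub>R a - real k *\<^sub>R b) + real k *\<^sub>R (real N' *\<^sub>R a - real l *\<^sub>R c)"
      by (simp add: algebra_simps)
    also have "\<dots> \<in> M" by (intro add scale b c)
    finally show "b + c \<in> S"
      using 1 b(1) c(1) unfolding S_def by (intro CollectI exI[of _ "k * l"] exI[of _ "l * N + k * N'"]) simp
  next
    have summand: "b \<in> S" if bc: "b \<in> sat" "c \<in> sat" "b + c \<in> S" for b c
    proof -
      obtain k N j j' where k: "k > 0" "real k *\<^sub>R (b + c) \<in> M" "real N *\<^sub>R a - real k *\<^sub>R (b + c) \<in> M"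
        and j: "j > 0" "real j *\<^sub>R b \<in> M" and j': "j' > 0" "real j' *\<^sub>R c \<in> M"
        using bc by (auto simp: S_def sat_def)
      have "real (k * j * j') *\<^sub>R b = real (k * j') *\<^sub>R (real j *\<^sub>R b)" by (simp add: ac_simps)
      also have "\<dots> \<in> M" by (intro scale j)
      finally have 1: "real (k * j * j') *\<^sub>R b \<in> M" .
      have "real (j * j' * N) *\<^sub>R a - real (k * j * j') *\<^sub>R b =
          real (j * j') *\<^sub>R (real N *\<^sub>R a - real k *\<^sub>R (b + c)) + real (k * j) *\<^sub>R (real j' *\<^sub>R c)"
        by (simp add: algebra_simps)
      also have "\<dots> \<in> M" by (intro add scale k j')
      finally show ?thesis
        using 1 k(1) j(1) j'(1) unfolding S_def
        by (intro CollectI exI[of _ "k * j * j'"] exI[of _ "j * j' * N"]) simp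
    qed
    assume "b + c \<in> S"
    then show "b \<in> S \<and> c \<in> S"
      using summand[of b c] summand[of c b] bc by (simp add: add.commute)
  qed
  have z_sat: "supp z \<subseteq> sat" using multiple by (auto simp: sat_def)
  have zz_sat: "supp (z ^ 2) \<subseteq> sat"
    unfolding power2_eq_square by (rule supp_mult_subset[OF z_sat z_sat sat_add])
  define w where "w = restrict_supp S z"
  have w2: "w ^ 2 = restrict_supp S (z ^ 2)"
    unfolding w_def power2_eq_square by (rule restrict_supp_mult[symmetric]) (use z_sat face in blast)
  have w3: "w ^ 3 = restrict_supp S (z ^ 3)"
  proof -
    have "w ^ 3 = w * w ^ 2" by (simp add: power3_eq_cube power2_eq_square ac_simps)
    also have "\<dots> = restrict_supp S (z * z ^ 2)"
      unfolding w2 unfolding w_def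
      by (rule restrict_supp_mult[symmetric]) (use z_sat zz_sat face in blast)
    also have "z * z ^ 2 = z ^ 3" by (simp add: power3_eq_cube power2_eq_square ac_simps)
    finally show ?thesis .
  qed
  define F where "F = S \<inter> M"
  have M_sat: "M \<subseteq> sat" unfolding sat_def by (auto intro!: exI[of _ "1::nat"])
  have F: "additive_submonoid F"
  proof -
    have "0 \<in> S" unfolding S_def using zero by (intro CollectI exI[of _ "1::nat"] exI[of _ "0::nat"]) simp
    then show ?thesis
      unfolding additive_submonoid_def F_def using zero add face M_sat by blast
  qed
  have F_lattice: "F \<subseteq> int_lattice" using M(2) by (auto simp: F_def)
  have F_gp: "group_closure F \<subseteq> group_closure M"
    by (rule group_closure_subset[OF _ zero_in_group_closure group_closure.diff])
      (auto simp: F_def intro: group_closure.base)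
  \<comment> \<open>\<open>w\<close> is the only root of its own square and cube, and one exists in the group algebra of \<open>F\<close>.\<close>
  obtain u' \<Phi>' where "lattice_subgroup (group_closure F) u' \<Phi>'"
    using lattice_subgroup_group_closure[OF F_lattice] by metis
  then interpret LF: lattice_subgroup "group_closure F" u' \<Phi>' .
  have F_base: "F \<subseteq> group_closure F" by (auto intro: group_closure.base)
  have "supp (w ^ 2) \<subseteq> F" "supp (w ^ 3) \<subseteq> F"
    using z(2,3) by (auto simp: w2 w3 supp_restrict_supp F_def)
  then have "supp (w ^ 2) \<subseteq> group_closure F" "supp (w ^ 3) \<subseteq> group_closure F"
    using F_base by blast+
  moreover have "(w ^ 3) ^ 2 = (w ^ 2) ^ 3" by (simp flip: power_mult)
  ultimately obtain w' where w': "supp w' \<subseteq> group_closure F" "w ^ 3 = w' ^ 3" "w ^ 2 = w' ^ 2"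
    using LF.square_cube_root by metis
  have "supp w \<subseteq> group_closure M" using z(1) by (auto simp: w_def supp_restrict_supp)
  moreover have "supp w' \<subseteq> group_closure M" using w'(1) F_gp by blast
  ultimately have "w = w'" using w'(2,3) L.square_cube_unique by blast
  have "a \<in> S"
  proof -
    obtain k where "k > 0" "real k *\<^sub>R a \<in> M" using multiple[OF a] by blast
    then show ?thesis unfolding S_def using zero by (intro CollectI exI[of _ k]) simp
  qed
  then have "a \<in> supp w" using a by (simp add: w_def supp_restrict_supp)
  then have "a \<in> group_closure F" using \<open>w = w'\<close> w'(1) by blast
  then obtain m1 m2 where m: "m1 \<in> F" "m2 \<in> F" "a = m1 - m2"
    using group_closure_submonoid[OF F] by metis
  \<comment> \<open>As \<open>m2\<close> lies in the face of \<open>a\<close>, it is absorbed by a multiple of \<open>a\<close>.\<close>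
  obtain k N where k: "k > 0" "real N *\<^sub>R a - real k *\<^sub>R m2 \<in> M"
    using m(2) by (auto simp: F_def S_def)
  have "real N *\<^sub>R a - m2 = (real N *\<^sub>R a - real k *\<^sub>R m2) + real (k - 1) *\<^sub>R m2"
    using k(1) by (simp add: algebra_simps of_nat_diff)
  also have "\<dots> \<in> M" using m(2) by (intro add scale k) (auto simp: F_def)
  finally have "real N *\<^sub>R a - m2 \<in> M" .
  moreover have "m1 \<in> M" "m2 \<in> M" using m by (auto simp: F_def)
  ultimately show "a \<in> M"
    using seminormal_monoid_interior[OF M(1,3) _ _ m(3)] by blast
qed

section \<open>Affine monoid rings\<close>

lemma affine_monoid_ring_simps:
  "carrier (affine_monoid_ring M :: (real ^ 'n \<Rightarrow>\<^sub>0 'k::field) ring) = {p. supp p \<subseteq> M}"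
  "x \<otimes>\<^bsub>affine_monoid_ring M\<^esub> y = x * y" "x \<oplus>\<^bsub>affine_monoid_ring M\<^esub> y = x + y"
  "\<one>\<^bsub>affine_monoid_ring M\<^esub> = 1" "\<zero>\<^bsub>affine_monoid_ring M\<^esub> = 0"
  by (simp_all add: affine_monoid_ring_def)

lemma affine_monoid_ring_pow: "x [^]\<^bsub>affine_monoid_ring M\<^esub> (n::nat) = x ^ n"
  by (induction n) (simp_all add: affine_monoid_ring_simps mult.commute)

lemma cring_affine_monoid_ring:
  fixes M :: "(real ^ 'n) set"
  assumes "additive_submonoid M"
  shows "cring (affine_monoid_ring M :: (real ^ 'n \<Rightarrow>\<^sub>0 'k::field) ring)"
proof (intro cringI abelian_groupI comm_monoidI; unfold affine_monoid_ring_simps mem_Collect_eq)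
  show "supp (x * y) \<subseteq> M" if "supp x \<subseteq> M" "supp y \<subseteq> M" for x y :: "real ^ 'n \<Rightarrow>\<^sub>0 'k"
    using that additive_submonoid_add[OF assms] by (rule supp_mult_subset)
  show "\<exists>y\<in>{p. supp p \<subseteq> M}. y + x = 0" if "supp x \<subseteq> M" for x :: "real ^ 'n \<Rightarrow>\<^sub>0 'k"
    using that by (intro bexI[of _ "- x"]) (auto simp: in_keys_iff)
  show "supp (x + y) \<subseteq> M" if "supp x \<subseteq> M" "supp y \<subseteq> M" for x y :: "real ^ 'n \<Rightarrow>\<^sub>0 'k"
    using that by (rule supp_add_subset)
qed (use additive_submonoid_zero[OF assms] in \<open>simp_all add: algebra_simps\<close>)

lemma reduced_affine_monoid_ring:
  fixes M :: "(real ^ 'n) set"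
  assumes "M \<subseteq> int_lattice"
  shows "reduced_ring (affine_monoid_ring M :: (real ^ 'n \<Rightarrow>\<^sub>0 'k::field) ring)"
proof -
  obtain u \<Phi> where "lattice_subgroup (group_closure M) u \<Phi>"
    using lattice_subgroup_group_closure[OF assms] by metis
  then interpret L: lattice_subgroup "group_closure M" u \<Phi> .
  have "M \<subseteq> group_closure M" by (auto intro: group_closure.base)
  then show ?thesis
    unfolding reduced_ring_def affine_monoid_ring_pow affine_monoid_ring_simps
    using L.power_neq_0 by blast
qed

section \<open>Toric face rings\<close>

lemma cone_face_sumD:
  assumes "cone_face F C" "a \<in> C" "b \<in> C" "a + b \<in> F"
  shows "a \<in> F"
  using assms(1) unfolding cone_face_def
proof (elim disjE exE conjE)
  fix v assume v: "\<forall>x\<in>C. 0 \<le> v \<bullet> x" "F = C \<inter> {x. v \<bullet> x = 0}"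
  then have "0 \<le> v \<bullet> a" "0 \<le> v \<bullet> b" "v \<bullet> a + v \<bullet> b = 0"
    using assms(2-4) by (auto simp: inner_add_right)
  then have "v \<bullet> a = 0" by linarith
  then show ?thesis using v(2) assms(2) by simp
qed (use assms in simp)

locale toric_complex =
  fixes \<Sigma> :: "(real ^ 'n) set set" and M :: "(real ^ 'n) set \<Rightarrow> (real ^ 'n) set"
  assumes fan: "rational_pointed_fan \<Sigma>" and complex: "monoidal_complex \<Sigma> M"
begin

lemma submonoid: "C \<in> \<Sigma> \<Longrightarrow> additive_submonoid (M C)"
proof -
  have "additive_submonoid (additive_submonoid hull S)" for S :: "(real ^ 'n) set"
    by (rule hull_in) (auto simp: additive_submonoid_def)
  then show "C \<in> \<Sigma> \<Longrightarrow> additive_submonoid (M C)"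
    using complex by (auto simp: monoidal_complex_def affine_monoid_def)
qed

lemma M_subset:
  assumes "C \<in> \<Sigma>" shows "M C \<subseteq> C" "M C \<subseteq> int_lattice"
  using complex assms by (simp_all add: monoidal_complex_def)

lemma rational_cone_M: "C \<in> \<Sigma> \<Longrightarrow> rational_cone (nonneg_combinations (M C))"
  using complex fan by (simp add: monoidal_complex_def rational_pointed_fan_def)

lemma inter_face: "C \<in> \<Sigma> \<Longrightarrow> D \<in> \<Sigma> \<Longrightarrow> cone_face (C \<inter> D) D"
  using fan by (simp add: rational_pointed_fan_def)

lemma inter_mem: "C \<in> \<Sigma> \<Longrightarrow> D \<in> \<Sigma> \<Longrightarrow> C \<inter> D \<in> \<Sigma>"
  using inter_face[of C D] fan unfolding rational_pointed_fan_def by meson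

lemma M_inter:
  assumes "C \<in> \<Sigma>" "D \<in> \<Sigma>" shows "M (C \<inter> D) = M C \<inter> M D"
proof -
  have "M (C \<inter> D) = M D \<inter> (C \<inter> D)"
    using complex assms inter_face[OF assms] by (simp add: monoidal_complex_def)
  moreover have "M (D \<inter> C) = M C \<inter> (D \<inter> C)"
    using complex assms inter_face[OF assms(2,1)] by (simp add: monoidal_complex_def)
  ultimately show ?thesis
    using M_subset[OF assms(1)] M_subset[OF assms(2)] by (auto simp: Int_commute)
qed

text \<open>
  The compatibility that makes restriction from the toric face ring to \<open>k[M\<^sub>C]\<close> multiplicative: \<open>C \<inter> D\<close>
  is a face of \<open>D\<close> that contains \<open>a + b\<close>, hence \<open>a\<close>, and the monoid of a face is cut out by the face.
\<close>
lemma M_summand: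
  assumes "C \<in> \<Sigma>" "D \<in> \<Sigma>" "a \<in> M D" "b \<in> M D" "a + b \<in> M C"
  shows "a \<in> M C"
proof -
  have "a + b \<in> M D" using additive_submonoid_add submonoid assms by metis
  then have "a + b \<in> C \<inter> D" using M_subset assms by blast
  then have "a \<in> C \<inter> D"
    using cone_face_sumD[OF inter_face[OF assms(1,2)]] M_subset assms by blast
  then have "a \<in> M D \<inter> (C \<inter> D)" using assms by simp
  also have "\<dots> = M (C \<inter> D)"
    using complex assms inter_face[OF assms(1,2)] by (simp add: monoidal_complex_def)
  finally show ?thesis using M_inter assms by blast
qed

abbreviation total :: "(real ^ 'n) set" where "total \<equiv> \<Union>C\<in>\<Sigma>. M C"

lemma toric_eqI:
  assumes "supp p \<subseteq> total" "supp q \<subseteq> total"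
    and "\<And>C. C \<in> \<Sigma> \<Longrightarrow> restrict_supp (M C) p = restrict_supp (M C) q"
  shows "p = q"
proof (rule poly_mapping_eqI)
  fix a
  show "coeff p a = coeff q a"
  proof (cases "a \<in> total")
    case True
    then obtain C where C: "C \<in> \<Sigma>" "a \<in> M C" by blast
    then show ?thesis
      using arg_cong[OF assms(3)[OF C(1)], of "\<lambda>r. coeff r a"] by (simp add: coeff_restrict_supp)
  next
    case False
    then have "a \<notin> supp p" "a \<notin> supp q" using assms(1,2) by blast+
    then show ?thesis by (simp add: in_keys_iff)
  qed
qed

text \<open>
  A pair of exponents contributes to the left side iff it has a common cone and its sum is in \<open>M\<^sub>C\<close>,
  and to the right side iff both exponents are in \<open>M\<^sub>C\<close>; these conditions agree.
\<close>
lemma restrict_toric_mult: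
  fixes p q :: "real ^ 'n \<Rightarrow>\<^sub>0 'k::field"
  assumes C: "C \<in> \<Sigma>"
  shows "restrict_supp (M C) (toric_mult \<Sigma> M p q) = restrict_supp (M C) p * restrict_supp (M C) q"
proof -
  have iff: "(\<exists>D\<in>\<Sigma>. a \<in> M D \<and> b \<in> M D) \<and> a + b \<in> M C \<longleftrightarrow> a \<in> M C \<and> b \<in> M C" for a b
  proof (intro iffI conjI; elim conjE bexE)
    fix D assume D: "a + b \<in> M C" "D \<in> \<Sigma>" "a \<in> M D" "b \<in> M D"
    show "a \<in> M C" by (rule M_summand[OF C D(2-4,1)])
    show "b \<in> M C" using M_summand[OF C D(2,4,3)] D(1) by (simp add: add.commute)
  qed (use C additive_submonoid_add[OF submonoid[OF C]] in auto)
  show ?thesis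
    unfolding toric_mult_def restrict_supp_mult_eq_sum restrict_supp_sum
    by (intro sum.cong refl) (use iff in \<open>auto simp: restrict_supp_monomial restrict_supp_0\<close>)
qed

lemma supp_toric_mult: "supp (toric_mult \<Sigma> M p q) \<subseteq> total"
proof -
  have "supp (if \<exists>C\<in>\<Sigma>. a \<in> M C \<and> b \<in> M C then monomial (a + b) (c :: 'k::field) else 0) \<subseteq> total" for a b c
    using additive_submonoid_add[OF submonoid] by auto
  then show ?thesis
    unfolding toric_mult_def by (intro order_trans[OF keys_sum] UN_least)
qed

lemma toric_mult_eq_mult:
  fixes p q :: "real ^ 'n \<Rightarrow>\<^sub>0 'k::field"
  assumes "C \<in> \<Sigma>" "supp p \<subseteq> M C" "supp q \<subseteq> M C"
  shows "toric_mult \<Sigma> M p q = p * q"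
  unfolding toric_mult_def mult_eq_sum_monomials[OF finite_keys order_refl finite_keys order_refl, of p q]
  by (intro sum.cong refl) (use assms in auto)

abbreviation T :: "(real ^ 'n \<Rightarrow>\<^sub>0 'k::field) ring" where "T \<equiv> toric_face_ring \<Sigma> M"

lemma T_simps:
  "carrier T = {p. supp p \<subseteq> total}"
  "x \<otimes>\<^bsub>T\<^esub> y = toric_mult \<Sigma> M x y" "x \<oplus>\<^bsub>T\<^esub> y = x + y"
  "\<one>\<^bsub>T\<^esub> = 1" "\<zero>\<^bsub>T\<^esub> = 0"
  by (simp_all add: toric_face_ring_def)

lemma restrict_one: "C \<in> \<Sigma> \<Longrightarrow> restrict_supp (M C) 1 = 1"
  using additive_submonoid_zero[OF submonoid] by (intro restrict_supp_id) auto

lemma supp_one_total: "supp (1 :: real ^ 'n \<Rightarrow>\<^sub>0 'k::field) \<subseteq> total"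
proof -
  obtain C where "C \<in> \<Sigma>" using fan unfolding rational_pointed_fan_def by blast
  then show ?thesis using additive_submonoid_zero[OF submonoid, of C] by auto
qed

text \<open>
  Each law holds after restriction to every \<open>M\<^sub>C\<close>, where the product is that of a commutative ring.
\<close>
lemma cring_T: "cring (T :: (real ^ 'n \<Rightarrow>\<^sub>0 'k::field) ring)"
proof (intro cringI abelian_groupI comm_monoidI; unfold T_simps mem_Collect_eq)
  note restrict = restrict_toric_mult restrict_supp_add restrict_one
  fix x y z :: "real ^ 'n \<Rightarrow>\<^sub>0 'k"
  assume x: "supp x \<subseteq> total"
  show "\<exists>y\<in>{p. supp p \<subseteq> total}. y + x = 0"
    using x by (intro bexI[of _ "- x"]) (auto simp: in_keys_iff)
  show "toric_mult \<Sigma> M 1 x = x"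
    by (rule toric_eqI[OF supp_toric_mult x]) (simp add: restrict)
  show "toric_mult \<Sigma> M x y = toric_mult \<Sigma> M y x"
    by (rule toric_eqI[OF supp_toric_mult supp_toric_mult]) (simp add: restrict mult.commute)
  show "toric_mult \<Sigma> M (toric_mult \<Sigma> M x y) z = toric_mult \<Sigma> M x (toric_mult \<Sigma> M y z)"
    by (rule toric_eqI[OF supp_toric_mult supp_toric_mult]) (simp add: restrict mult.assoc)
  show "toric_mult \<Sigma> M (x + y) z = toric_mult \<Sigma> M x z + toric_mult \<Sigma> M y z"
    by (rule toric_eqI[OF supp_toric_mult supp_add_subset[OF supp_toric_mult supp_toric_mult]])
      (simp add: restrict distrib_right)
  show "supp (x + y) \<subseteq> total" if "supp y \<subseteq> total"
    using x that by (rule supp_add_subset)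
qed (use supp_one_total in \<open>simp_all add: supp_toric_mult add_ac\<close>)

lemma supp_pow:
  assumes "supp (x :: real ^ 'n \<Rightarrow>\<^sub>0 'k::field) \<subseteq> total"
  shows "supp (x [^]\<^bsub>T\<^esub> (n::nat)) \<subseteq> total"
  by (cases n) (use supp_one_total supp_toric_mult in \<open>auto simp: T_simps\<close>)

lemma restrict_pow:
  "C \<in> \<Sigma> \<Longrightarrow> restrict_supp (M C) (x [^]\<^bsub>T\<^esub> (n::nat)) = restrict_supp (M C) x ^ n"
  by (induction n) (simp_all add: T_simps restrict_one restrict_toric_mult mult.commute)

lemma pow_eq_power:
  fixes x :: "real ^ 'n \<Rightarrow>\<^sub>0 'k::field"
  assumes "C \<in> \<Sigma>" "supp x \<subseteq> M C"
  shows "x [^]\<^bsub>T\<^esub> (n::nat) = x ^ n"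
proof (induction n)
  case (Suc n)
  have "supp (x ^ n) \<subseteq> M C"
    using supp_power_subset[OF assms(2)] submonoid[OF assms(1)]
      additive_submonoid_zero additive_submonoid_add by metis
  then show ?case
    using Suc assms by (simp add: T_simps toric_mult_eq_mult mult.commute)
qed (simp add: T_simps)

text \<open>
  Restriction to \<open>M\<^sub>C\<close> is a retraction of rings; it maps a root in the big ring to a root in the small one.
\<close>
lemma seminormal_affine_if_toric:
  assumes T: "seminormal_ring (T :: (real ^ 'n \<Rightarrow>\<^sub>0 'k::field) ring)" and C: "C \<in> \<Sigma>"
  shows "seminormal_ring (affine_monoid_ring (M C) :: (real ^ 'n \<Rightarrow>\<^sub>0 'k) ring)"
  unfolding seminormal_ring_def affine_monoid_ring_pow affine_monoid_ring_simps
proof (intro conjI ballI impI)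
  show "cring (affine_monoid_ring (M C) :: (real ^ 'n \<Rightarrow>\<^sub>0 'k) ring)"
    by (rule cring_affine_monoid_ring[OF submonoid[OF C]])
  show "reduced_ring (affine_monoid_ring (M C) :: (real ^ 'n \<Rightarrow>\<^sub>0 'k) ring)"
    by (rule reduced_affine_monoid_ring[OF M_subset(2)[OF C]])
  fix x y :: "real ^ 'n \<Rightarrow>\<^sub>0 'k"
  assume xy: "x \<in> {p. supp p \<subseteq> M C}" "y \<in> {p. supp p \<subseteq> M C}" "x ^ 2 = y ^ 3"
  then have "x \<in> carrier T" "y \<in> carrier T" "x [^]\<^bsub>T\<^esub> (2::nat) = y [^]\<^bsub>T\<^esub> (3::nat)"
    using C by (auto simp: T_simps pow_eq_power[OF C])
  then obtain z where z: "x = z [^]\<^bsub>T\<^esub> (3::nat)" "y = z [^]\<^bsub>T\<^esub> (2::nat)"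
    using T unfolding seminormal_ring_def by blast
  let ?z = "restrict_supp (M C) z"
  have "x = restrict_supp (M C) x" "y = restrict_supp (M C) y"
    using xy by (simp_all add: restrict_supp_id)
  then have "x = ?z ^ 3" "y = ?z ^ 2"
    using z restrict_pow[OF C, of z] by metis+
  then show "\<exists>z\<in>{p. supp p \<subseteq> M C}. x = z ^ 3 \<and> y = z ^ 2"
    by (intro bexI[of _ ?z]) (auto simp: supp_restrict_supp)
qed

lemma lattice_subgroup_M:
  assumes "C \<in> \<Sigma>"
  obtains u \<Phi> where "lattice_subgroup (group_closure (M C)) u \<Phi>"
  using lattice_subgroup_group_closure M_subset(2)[OF assms] by metis

lemma M_subset_group_closure: "M C \<subseteq> group_closure (M C)"
  by (auto intro: group_closure.base)

lemma square_cube_unique_M: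
  fixes z z' :: "real ^ 'n \<Rightarrow>\<^sub>0 'k::field"
  assumes "C \<in> \<Sigma>" "supp z \<subseteq> M C" "supp z' \<subseteq> M C" "z ^ 2 = z' ^ 2" "z ^ 3 = z' ^ 3"
  shows "z = z'"
proof -
  obtain u \<Phi> where "lattice_subgroup (group_closure (M C)) u \<Phi>"
    using lattice_subgroup_M[OF assms(1)] by metis
  then interpret L: lattice_subgroup "group_closure (M C)" u \<Phi> .
  show ?thesis
    by (rule L.square_cube_unique) (use assms M_subset_group_closure in blast)+
qed

lemma square_cube_root_M:
  fixes x y :: "real ^ 'n \<Rightarrow>\<^sub>0 'k::field"
  assumes "C \<in> \<Sigma>" "seminormal_monoid (M C)" "supp x \<subseteq> M C" "supp y \<subseteq> M C" "x ^ 2 = y ^ 3"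
  shows "\<exists>z. supp z \<subseteq> M C \<and> x = z ^ 3 \<and> y = z ^ 2"
proof -
  obtain u \<Phi> where "lattice_subgroup (group_closure (M C)) u \<Phi>"
    using lattice_subgroup_M[OF assms(1)] by metis
  then interpret L: lattice_subgroup "group_closure (M C)" u \<Phi> .
  have "supp x \<subseteq> group_closure (M C)" "supp y \<subseteq> group_closure (M C)"
    using assms(3,4) M_subset_group_closure by blast+
  then obtain z where z: "supp z \<subseteq> group_closure (M C)" "x = z ^ 3" "y = z ^ 2"
    using L.square_cube_root assms(5) by metis
  have "supp z \<subseteq> M C"
    using seminormal_monoid_root_closed[OF submonoid M_subset(2) assms(2) rational_cone_M z(1)] assms z
    by simp
  with z show ?thesis by blast
qed

lemma reduced_T: "reduced_ring (T :: (real ^ 'n \<Rightarrow>\<^sub>0 'k::field) ring)"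
  unfolding reduced_ring_def
proof (intro ballI allI impI)
  fix x :: "real ^ 'n \<Rightarrow>\<^sub>0 'k" and n :: nat
  assume x: "x \<in> carrier T" "x [^]\<^bsub>T\<^esub> n = \<zero>\<^bsub>T\<^esub>"
  have "restrict_supp (M C) x = 0" if C: "C \<in> \<Sigma>" for C
  proof -
    have "restrict_supp (M C) x ^ n = 0"
      using restrict_pow[OF C, of x n] x(2) by (simp add: T_simps restrict_supp_0)
    moreover have "supp (restrict_supp (M C) x) \<subseteq> M C" by (simp add: supp_restrict_supp)
    ultimately show ?thesis
      using reduced_affine_monoid_ring[OF M_subset(2)[OF C]]
      unfolding reduced_ring_def affine_monoid_ring_pow affine_monoid_ring_simps by blast
  qed
  then have "x = 0"
    using x(1) by - (rule toric_eqI, simp_all add: T_simps restrict_supp_0)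
  then show "x = \<zero>\<^bsub>T\<^esub>" by (simp add: T_simps)
qed

text \<open>
  Two cones that share the exponent \<open>a\<close> prescribe the same coefficient at \<open>a\<close>, because their
  intersection is a cone of the fan whose monoid contains \<open>a\<close>.
\<close>
lemma glue:
  fixes Z :: "(real ^ 'n) set \<Rightarrow> (real ^ 'n \<Rightarrow>\<^sub>0 'k::field)"
  assumes supp: "\<And>C. C \<in> \<Sigma> \<Longrightarrow> supp (Z C) \<subseteq> M C"
    and compat: "\<And>C D. C \<in> \<Sigma> \<Longrightarrow> D \<in> \<Sigma> \<Longrightarrow> restrict_supp (M (C \<inter> D)) (Z C) = Z (C \<inter> D)"
  obtains z where "supp z \<subseteq> total" "\<And>C. C \<in> \<Sigma> \<Longrightarrow> restrict_supp (M C) z = Z C"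
proof -
  have agree: "coeff (Z C) a = coeff (Z D) a" if *: "C \<in> \<Sigma>" "D \<in> \<Sigma>" "a \<in> M C" "a \<in> M D" for C D a
  proof -
    have a: "a \<in> M (C \<inter> D)" using M_inter * by simp
    have "coeff (Z C) a = coeff (Z (C \<inter> D)) a"
      using arg_cong[OF compat[OF *(1,2)], of "\<lambda>r. coeff r a"] a by (simp add: coeff_restrict_supp)
    moreover have "coeff (Z D) a = coeff (Z (C \<inter> D)) a"
      using arg_cong[OF compat[OF *(2,1)], of "\<lambda>r. coeff r a"] a
      by (simp add: coeff_restrict_supp Int_commute)
    ultimately show ?thesis by simp
  qed
  define cone where "cone a = (SOME C. C \<in> \<Sigma> \<and> a \<in> M C)" for a
  have cone: "cone a \<in> \<Sigma>" "a \<in> M (cone a)" if "a \<in> total" for a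
    using someI_ex[of "\<lambda>C. C \<in> \<Sigma> \<and> a \<in> M C"] that by (auto simp: cone_def)
  define f where "f a = (if a \<in> total then coeff (Z (cone a)) a else 0)" for a
  have "{a. f a \<noteq> 0} \<subseteq> (\<Union>C\<in>\<Sigma>. supp (Z C))"
  proof
    fix a assume "a \<in> {a. f a \<noteq> 0}"
    then have "a \<in> total" "a \<in> supp (Z (cone a))"
      by (auto simp: f_def in_keys_iff split: if_splits)
    then show "a \<in> (\<Union>C\<in>\<Sigma>. supp (Z C))" using cone(1) by blast
  qed
  moreover have "finite (\<Union>C\<in>\<Sigma>. supp (Z C))"
    using fan by (simp add: rational_pointed_fan_def)
  ultimately have "finite {a. f a \<noteq> 0}" by (rule finite_subset)
  then have coeff_z: "coeff (Abs_poly_mapping f) = f" by simp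
  show ?thesis
  proof (rule that[of "Abs_poly_mapping f"])
    show "supp (Abs_poly_mapping f) \<subseteq> total"
      by (auto simp: in_keys_iff coeff_z f_def split: if_splits)
    fix C assume C: "C \<in> \<Sigma>"
    show "restrict_supp (M C) (Abs_poly_mapping f) = Z C"
    proof (rule poly_mapping_eqI)
      fix a
      show "coeff (restrict_supp (M C) (Abs_poly_mapping f)) a = coeff (Z C) a"
      proof (cases "a \<in> M C")
        case True
        then have "a \<in> total" using C by blast
        then show ?thesis
          using agree[OF C cone(1) True cone(2)] True by (simp add: coeff_restrict_supp coeff_z f_def)
      next
        case False
        then have "a \<notin> supp (Z C)" using supp[OF C] by blast
        then show ?thesis using False by (simp add: coeff_restrict_supp in_keys_iff)
      qed
    qed
  qed
qed

text \<open>
  The roots over two cones restrict to roots of the same equation over the intersection, where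
  roots are unique; so they glue.
\<close>
lemma seminormal_toric_if_monoids:
  assumes sn: "\<forall>C\<in>\<Sigma>. seminormal_monoid (M C)"
  shows "seminormal_ring (T :: (real ^ 'n \<Rightarrow>\<^sub>0 'k::field) ring)"
  unfolding seminormal_ring_def
proof (intro conjI ballI impI cring_T reduced_T)
  fix x y :: "real ^ 'n \<Rightarrow>\<^sub>0 'k"
  assume x: "x \<in> carrier T" and y: "y \<in> carrier T"
    and xy: "x [^]\<^bsub>T\<^esub> (2::nat) = y [^]\<^bsub>T\<^esub> (3::nat)"
  have "\<exists>z. supp z \<subseteq> M C \<and> restrict_supp (M C) x = z ^ 3 \<and> restrict_supp (M C) y = z ^ 2"
    if C: "C \<in> \<Sigma>" for C
  proof (rule square_cube_root_M[OF C])
    show "restrict_supp (M C) x ^ 2 = restrict_supp (M C) y ^ 3"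
      using restrict_pow[OF C, of x 2] restrict_pow[OF C, of y 3] xy by simp
  qed (use sn C in \<open>auto simp: supp_restrict_supp\<close>)
  then obtain Z where Z: "\<And>C. C \<in> \<Sigma> \<Longrightarrow> supp (Z C) \<subseteq> M C"
      "\<And>C. C \<in> \<Sigma> \<Longrightarrow> restrict_supp (M C) x = Z C ^ 3"
      "\<And>C. C \<in> \<Sigma> \<Longrightarrow> restrict_supp (M C) y = Z C ^ 2"
    by metis
  have compat: "restrict_supp (M (C \<inter> D)) (Z C) = Z (C \<inter> D)" if CD: "C \<in> \<Sigma>" "D \<in> \<Sigma>" for C D
  proof -
    let ?E = "C \<inter> D"
    note E = inter_mem[OF CD]
    have ME: "M ?E \<inter> M C = M ?E" using M_inter[OF CD] by blast
    have pow: "restrict_supp (M ?E) (Z C) ^ n = restrict_supp (M ?E) (Z C ^ n)" for n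
      using restrict_pow[OF E, of "Z C" n] pow_eq_power[OF CD(1) Z(1)[OF CD(1)], of n] by simp
    have "restrict_supp (M ?E) (Z C) ^ 3 = Z ?E ^ 3"
      unfolding pow Z(2)[OF CD(1), symmetric] Z(2)[OF E, symmetric] restrict_supp_restrict_supp ME ..
    moreover have "restrict_supp (M ?E) (Z C) ^ 2 = Z ?E ^ 2"
      unfolding pow Z(3)[OF CD(1), symmetric] Z(3)[OF E, symmetric] restrict_supp_restrict_supp ME ..
    moreover have "supp (restrict_supp (M ?E) (Z C)) \<subseteq> M ?E"
      by (simp add: supp_restrict_supp)
    ultimately show ?thesis
      using square_cube_unique_M[OF E _ Z(1)[OF E]] by blast
  qed
  obtain z where z: "supp z \<subseteq> total" "\<And>C. C \<in> \<Sigma> \<Longrightarrow> restrict_supp (M C) z = Z C"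
    using glue[OF Z(1) compat] by metis
  have "x = z [^]\<^bsub>T\<^esub> (3::nat)"
    by (rule toric_eqI) (use x supp_pow[OF z(1)] in \<open>auto simp: T_simps restrict_pow z(2) Z(2)\<close>)
  moreover have "y = z [^]\<^bsub>T\<^esub> (2::nat)"
    by (rule toric_eqI) (use y supp_pow[OF z(1)] in \<open>auto simp: T_simps restrict_pow z(2) Z(3)\<close>)
  ultimately show "\<exists>z\<in>carrier T. x = z [^]\<^bsub>T\<^esub> (3::nat) \<and> y = z [^]\<^bsub>T\<^esub> (2::nat)"
    using z(1) by (intro bexI[of _ z]) (simp_all add: T_simps)
qed

end

theorem proposition3p4:
  fixes \<Sigma> :: "(real ^ 'n) set set"
    and M :: "(real ^ 'n) set \<Rightarrow> (real ^ 'n) set"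
  assumes "rational_pointed_fan \<Sigma>"
    and "monoidal_complex \<Sigma> M"
  shows "(seminormal_ring (toric_face_ring \<Sigma> M :: (real ^ 'n \<Rightarrow>\<^sub>0 'k::field) ring) \<longrightarrow>
           (\<forall>C\<in>\<Sigma>. seminormal_ring (affine_monoid_ring (M C) :: (real ^ 'n \<Rightarrow>\<^sub>0 'k) ring))) \<and>
         ((\<forall>C\<in>\<Sigma>. seminormal_monoid (M C)) \<longrightarrow>
           seminormal_ring (toric_face_ring \<Sigma> M :: (real ^ 'n \<Rightarrow>\<^sub>0 'k) ring))"
proof -
  have "toric_complex \<Sigma> M" by (rule toric_complex.intro[OF assms])
  then interpret toric_complex \<Sigma> M .
  show ?thesis
    using seminormal_affine_if_toric seminormal_toric_if_monoids by blast
qed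

end
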